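(* Assume $n_1=\cdots=n_m=n$ and let $\mathcal M=2^{\{1,\dots,m\}}$ be the collection of all subsets of $\{1,\dots,m\}$, with corresponding model-selection estimator $\widehat\theta_0^{\mathrm{MS}}$. In the transfer-relevant regime $n_0\ll mn$ there is a universal constant $C>0$ such that, i.e. along any sequence of parameters $(m,n,n_0,d,\tau)$ with $d\tau^2/n_0\le1$ and $n_0/(mn)\to0$, one has, eventually along the sequence, $$\mathfrak C^\star([0,1]^m)\;\le\;\mathfrak C(\widehat\theta_0^{\mathrm{MS}},[0,1]^m)\;\le\;C\left[\left\{\left(1\wedge\frac md\right)\frac{mn}{n_0}\right\}\vee1\right].$$
   Context: There are $m+1$ domains ($k=0$ target, $k=1,\dots,m$ sources), with parameters $\theta_0^\star,\dots,\theta_m^\star\in\mathbb R^d$, sample sizes $\boldsymbol n=(n_0,\dots,n_m)$ and local estimators $\widetilde\theta_0,\dots,\widetilde\theta_m$. A constant $C_\tau>0$ is fixed throughout and suppressed from notation. For $\boldsymbol h\in[0,1]^m$, $\mathcal P(\boldsymbol h,\boldsymbol n,\tau)$ is the set of joint distributions of $(\widetilde\theta_0,\dots,\widetilde\theta_m)$ such that the $\widetilde\theta_k$ are independent and there exist $\theta_0^\star,\dots,\theta_m^\star\in\mathbb R^d$ with $\|\theta_k^\star-\theta_0^\star\|_2\le h_k$ for $k=1,\dots,m$ and $\max_{\|a\|_2=1}P(a^\top(\widetilde\theta_k-\theta_k^\star)>t)\le C_\tau\exp(-n_kt^2/(2\tau^2))$ for all $t>0$ and $k=0,\dots,m$. Oracle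 rate: with $h_0:=0$, $\mathfrak R(\boldsymbol h,\boldsymbol n,\tau):=\min_{\{0\}\subset S\subset\{0,\dots,m\}}\{d\tau^2/\sum_{k\in S}n_k+\max_{k\in S}h_k^2\}$. For $\mathcal H\subset[0,1]^m$ and an estimator $\widehat\theta_0$ not depending on $\boldsymbol h$ (but possibly on $\boldsymbol n,\tau$), the adaptation cost is $\mathfrak C(\widehat\theta_0,\mathcal H):=\sup_{\boldsymbol h\in\mathcal H}\dfrac{\sup_{P\in\mathcal P(\boldsymbol h,\boldsymbol n,\tau)}\mathbb E_P[\|\widehat\theta_0-\theta_0^\star\|_2^2]}{\mathfrak R(\boldsymbol h,\boldsymbol n,\tau)}$, and the intrinsic cost of adaptation is $\mathfrak C^\star(\mathcal H):=\inf_{\widehat\theta_0}\mathfrak C(\widehat\theta_0,\mathcal H)$. Model-selection estimator: the target data are split into two equal halves, giving two independent estimators $\widetilde\theta_0^{(1)},\widetilde\theta_0^{(2)}$ of $\theta_0^\star$, independent of $\widetilde\theta_1,\dots,\widetilde\theta_m$, each satisfying $\max_{\|a\|_2=1}P(a^\top(\widetilde\theta_0^{(i)}-\theta_0^\star)>t)\le C_\tau\exp(-n_0t^2/(4\tau^2))$ for all $t>0$ ($i=1,2$). (For estimators using the split, expectations in the cost are over the joint law of $\widetilde\theta_0^{(1)},\widetilde\theta_0^{(2)},\widetilde\theta_1,\dots,\widetilde\theta_m$, and such estimators are admitted.) Given $\mathcal M=\{S_1,\dots,S_M\}$ a family of subsets of $\{1,\dots,m\}$, put $\xi_j=\dfrac{\sum_{k\in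 S_j}n_k\widetilde\theta_k+\frac{n_0}2\widetilde\theta_0^{(2)}}{\sum_{k\in S_j}n_k+\frac{n_0}2}$ and $\widehat\theta_0^{\mathrm{MS}}:=\xi_{\hat j}$ with $\hat j\in\arg\min_{j}\|\xi_j-\widetilde\theta_0^{(1)}\|_2^2$. $a\wedge b=\min(a,b)$, $a\vee b=\max(a,b)$. *)

theory Defs
  imports "HOL-Probability.Probability"
begin

text \<open>
  The dimension \<open>d\<close> varies along sequences, so a vector of \<open>\<real>\<^sup>d\<close> is a function \<open>nat \<Rightarrow> real\<close> on
  the coordinates \<open>{..<d}\<close>; its Euclidean norm is \<open>L2_set x {..<d}\<close>.
\<close>

definition vec_space :: "nat \<Rightarrow> (nat \<Rightarrow> real) measure" where
  "vec_space d = PiM {..<d} (\<lambda>_. borel)"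

text \<open>
  The possible local estimators: the one based on the whole target sample, the ones based on its
  two halves, and the one of source \<open>k\<close>.
\<close>

datatype obs = Target | Half1 | Half2 | Source nat

fun domain_of :: "obs \<Rightarrow> nat" where
  "domain_of (Source k) = k"
| "domain_of Target = 0"
| "domain_of Half1 = 0"
| "domain_of Half2 = 0"

text \<open>
  A half of the target data has effective sample size \<open>n 0 / 2\<close>, so the tail bound
  \<open>exp (- obs_size n b * t\<^sup>2 / (2 * \<tau>\<^sup>2))\<close> below becomes \<open>exp (- n 0 * t\<^sup>2 / (4 * \<tau>\<^sup>2))\<close> for it.
\<close>

fun obs_size :: "(nat \<Rightarrow> nat) \<Rightarrow> obs \<Rightarrow> real" where
  "obs_size n (Source k) = real (n k)"
| "obs_size n Target = real (n 0)"
| "obs_size n Half1 = real (n 0) / 2"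
| "obs_size n Half2 = real (n 0) / 2"

definition plain_design :: "nat \<Rightarrow> obs set" where
  "plain_design m = insert Target (Source ` {1..m})"

definition split_design :: "nat \<Rightarrow> obs set" where
  "split_design m = {Half1, Half2} \<union> Source ` {1..m}"

definition data_space :: "obs set \<Rightarrow> nat \<Rightarrow> (obs \<Rightarrow> nat \<Rightarrow> real) measure" where
  "data_space D d = PiM D (\<lambda>_. vec_space d)"

text \<open>
  \<open>P\<close> is a joint law of the local estimators in the design \<open>D\<close> that belongs to the class
  with heterogeneity \<open>h\<close>, as witnessed by the true parameters \<open>\<theta> 0, \<dots>, \<theta> m\<close>.
\<close>

definition admissible ::
  "real \<Rightarrow> nat \<Rightarrow> nat \<Rightarrow> (nat \<Rightarrow> nat) \<Rightarrow> real \<Rightarrow> obs set \<Rightarrow> (nat \<Rightarrow> real) \<Rightarrow>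
    (nat \<Rightarrow> nat \<Rightarrow> real) \<Rightarrow> (obs \<Rightarrow> nat \<Rightarrow> real) measure \<Rightarrow> bool" where
  "admissible C\<tau> d m n \<tau> D h \<theta> P \<longleftrightarrow>
     prob_space P \<and> sets P = sets (data_space D d) \<and>
     prob_space.indep_vars P (\<lambda>_. vec_space d) (\<lambda>b x. x b) D \<and>
     (\<forall>k\<in>{1..m}. L2_set (\<lambda>i. \<theta> k i - \<theta> 0 i) {..<d} \<le> h k) \<and>
     (\<forall>b\<in>D. \<forall>a t. L2_set a {..<d} = 1 \<longrightarrow> t > 0 \<longrightarrow>
        measure P {x \<in> space P. (\<Sum>i<d. a i * (x b i - \<theta> (domain_of b) i)) > t}
          \<le> C\<tau> * exp (- obs_size n b * t\<^sup>2 / (2 * \<tau>\<^sup>2)))"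

text \<open>
  The tail bounds do not determine the parameters from the law, so the worst case is taken over
  all pairs of a law and parameters witnessing its membership in the class.
\<close>

definition worst_risk ::
  "real \<Rightarrow> nat \<Rightarrow> nat \<Rightarrow> (nat \<Rightarrow> nat) \<Rightarrow> real \<Rightarrow> obs set \<Rightarrow>
    ((obs \<Rightarrow> nat \<Rightarrow> real) \<Rightarrow> nat \<Rightarrow> real) \<Rightarrow> (nat \<Rightarrow> real) \<Rightarrow> ennreal" where
  "worst_risk C\<tau> d m n \<tau> D est h =
     (SUP (\<theta>, P) \<in> {(\<theta>, P). admissible C\<tau> d m n \<tau> D h \<theta> P}.
        \<integral>\<^sup>+ x. ennreal ((L2_set (\<lambda>i. est x i - \<theta> 0 i) {..<d})\<^sup>2) \<partial>P)"

definition oracle_rate ::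
  "nat \<Rightarrow> nat \<Rightarrow> (nat \<Rightarrow> nat) \<Rightarrow> real \<Rightarrow> (nat \<Rightarrow> real) \<Rightarrow> real" where
  "oracle_rate d m n \<tau> h =
     Min ((\<lambda>S. real d * \<tau>\<^sup>2 / real (\<Sum>k\<in>S. n k) + Max ((\<lambda>k. ((h(0 := 0)) k)\<^sup>2) ` S))
          ` {S. {0} \<subseteq> S \<and> S \<subseteq> {0..m}})"

definition adaptation_cost ::
  "real \<Rightarrow> nat \<Rightarrow> nat \<Rightarrow> (nat \<Rightarrow> nat) \<Rightarrow> real \<Rightarrow> obs set \<Rightarrow>
    ((obs \<Rightarrow> nat \<Rightarrow> real) \<Rightarrow> nat \<Rightarrow> real) \<Rightarrow> (nat \<Rightarrow> real) set \<Rightarrow> ennreal" where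
  "adaptation_cost C\<tau> d m n \<tau> D est H =
     (SUP h\<in>H. worst_risk C\<tau> d m n \<tau> D est h / ennreal (oracle_rate d m n \<tau> h))"

text \<open>Both estimators using the whole target sample and estimators using its split compete.\<close>

definition intrinsic_cost ::
  "real \<Rightarrow> nat \<Rightarrow> nat \<Rightarrow> (nat \<Rightarrow> nat) \<Rightarrow> real \<Rightarrow> (nat \<Rightarrow> real) set \<Rightarrow> ennreal" where
  "intrinsic_cost C\<tau> d m n \<tau> H =
     (INF (D, est) \<in> (SIGMA D:{plain_design m, split_design m}. data_space D d \<rightarrow>\<^sub>M vec_space d).
        adaptation_cost C\<tau> d m n \<tau> D est H)"

definition unit_cube :: "nat \<Rightarrow> (nat \<Rightarrow> real) set" where
  "unit_cube m = PiE {1..m} (\<lambda>_. {0..1})"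

definition ms_candidate ::
  "nat \<Rightarrow> (nat \<Rightarrow> nat) \<Rightarrow> nat set \<Rightarrow> (obs \<Rightarrow> nat \<Rightarrow> real) \<Rightarrow> nat \<Rightarrow> real" where
  "ms_candidate d n S x =
     (\<lambda>i\<in>{..<d}. ((\<Sum>k\<in>S. real (n k) * x (Source k) i) + real (n 0) / 2 * x Half2 i)
                 / ((\<Sum>k\<in>S. real (n k)) + real (n 0) / 2))"

text \<open>
  The minimiser need not be unique; a selector is any measurable choice of a minimising subset.
\<close>

definition ms_selector ::
  "nat \<Rightarrow> nat \<Rightarrow> (nat \<Rightarrow> nat) \<Rightarrow> nat set set \<Rightarrow> ((obs \<Rightarrow> nat \<Rightarrow> real) \<Rightarrow> nat set) \<Rightarrow> bool" where
  "ms_selector d m n \<M> J \<longleftrightarrow>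
     J \<in> data_space (split_design m) d \<rightarrow>\<^sub>M count_space \<M> \<and>
     (\<forall>x\<in>space (data_space (split_design m) d).
        is_arg_min (\<lambda>S. (L2_set (\<lambda>i. ms_candidate d n S x i - x Half1 i) {..<d})\<^sup>2)
          (\<lambda>S. S \<in> \<M>) (J x))"

definition ms_estimator ::
  "nat \<Rightarrow> (nat \<Rightarrow> nat) \<Rightarrow> ((obs \<Rightarrow> nat \<Rightarrow> real) \<Rightarrow> nat set) \<Rightarrow> (obs \<Rightarrow> nat \<Rightarrow> real) \<Rightarrow> nat \<Rightarrow> real" where
  "ms_estimator d n J x = ms_candidate d n (J x) x"

lemma measurable_obs_coord [measurable]:
  assumes "b \<in> D" "i < d"
  shows "(\<lambda>x. x b i) \<in> borel_measurable (data_space D d)"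
proof -
  have 1: "(\<lambda>x. x b) \<in> data_space D d \<rightarrow>\<^sub>M vec_space d"
    unfolding data_space_def using assms by simp
  have 2: "(\<lambda>v. v i) \<in> borel_measurable (vec_space d)"
    unfolding vec_space_def using assms by simp
  show ?thesis using measurable_compose[OF 1 2] .
qed

text \<open>Measurable selectors exist, so quantifying over all of them is not vacuous.\<close>

lemma ms_selector_exists:
  assumes M: "\<M> \<subseteq> Pow {1..m}" "\<M> \<noteq> {}"
  shows "\<exists>J. ms_selector d m n \<M> J"
proof -
  let ?X = "data_space (split_design m) d"
  define f where "f S x = (L2_set (\<lambda>i. ms_candidate d n S x i - x Half1 i) {..<d})\<^sup>2" for S x
  have fin: "finite \<M>" using M(1) finite_subset by blast
  obtain L where L: "set L = \<M>" using finite_list[OF fin] by blast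
  have f_meas: "f S \<in> borel_measurable ?X" if "S \<in> \<M>" for S
  proof -
    have S: "Source k \<in> split_design m" if "k \<in> S" for k
      using \<open>S \<in> \<M>\<close> M(1) that by (auto simp: split_design_def)
    have H: "Half1 \<in> split_design m" "Half2 \<in> split_design m" by (auto simp: split_design_def)
    have "(\<lambda>x. ms_candidate d n S x i - x Half1 i) \<in> borel_measurable ?X" if "i < d" for i
      unfolding ms_candidate_def using that
      by (auto intro!: borel_measurable_diff borel_measurable_divide borel_measurable_add
          borel_measurable_sum borel_measurable_times borel_measurable_const
          measurable_obs_coord S H)
    then show ?thesis unfolding f_def L2_set_def
      by (intro borel_measurable_power borel_measurable_sqrt borel_measurable_sum) auto
  qed
  define Q where "Q k x \<longleftrightarrow> k < length L \<and> (\<forall>T\<in>\<M>. f (L ! k) x \<le> f T x)" for k x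
  define K where "K x = (LEAST k. Q k x)" for x
  have Q_ex: "\<exists>k. Q k x" for x
  proof -
    have "Min ((\<lambda>S. f S x) ` \<M>) \<in> (\<lambda>S. f S x) ` \<M>" using fin M(2) by (intro Min_in) auto
    then obtain S where S: "S \<in> \<M>" "f S x = Min ((\<lambda>S. f S x) ` \<M>)" by auto
    have "\<forall>T\<in>\<M>. f S x \<le> f T x" using S fin by auto
    moreover obtain k where "k < length L" "L ! k = S" using S(1) L by (metis in_set_conv_nth)
    ultimately show ?thesis unfolding Q_def by auto
  qed
  have QK: "Q (K x) x" for x unfolding K_def using Q_ex by (rule LeastI_ex)
  have Q_meas: "Measurable.pred ?X (Q k)" for k
  proof (cases "k < length L")
    case True
    then have Lk: "L ! k \<in> \<M>" using L nth_mem by blast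
    have "Measurable.pred ?X (\<lambda>x. \<forall>T\<in>\<M>. f (L ! k) x \<le> f T x)"
      using fin
    proof (rule pred_intros_finite)
      fix T assume "T \<in> \<M>"
      then show "Measurable.pred ?X (\<lambda>x. f (L ! k) x \<le> f T x)"
        using borel_measurable_le[OF f_meas[OF Lk] f_meas[of T]] by (simp add: pred_def)
    qed
    then show ?thesis using True by (simp add: Q_def[abs_def])
  next
    case False then show ?thesis by (simp add: Q_def[abs_def])
  qed
  have K_meas: "K \<in> ?X \<rightarrow>\<^sub>M count_space UNIV"
    unfolding K_def[abs_def] by (rule measurable_Least) (use Q_meas in \<open>simp add: measurable_def pred_def\<close>)
  have in_M: "L ! K x \<in> \<M>" for x using QK[of x] L by (auto simp: Q_def)
  have "(\<lambda>x. L ! K x) \<in> ?X \<rightarrow>\<^sub>M count_space UNIV"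
    by (rule measurable_compose[OF K_meas]) simp
  then have "(\<lambda>x. L ! K x) \<in> ?X \<rightarrow>\<^sub>M count_space \<M>"
    using in_M by (intro measurableI) (auto dest: measurable_sets)
  moreover have "is_arg_min (\<lambda>S. f S x) (\<lambda>S. S \<in> \<M>) (L ! K x)" for x
    using QK[of x] in_M[of x] by (auto simp: is_arg_min_def Q_def not_less)
  ultimately show ?thesis unfolding ms_selector_def f_def by blast
qed

end

theory Submission imports Defs begin

text \<open>
  Write \<open>\<theta>\<^sub>0\<close> for the target parameter, \<open>e\<close> for the error of the first half of the target sample and
  \<open>\<xi>\<^sub>S\<close> for the candidate that pools the sources in \<open>S\<close> with the second half. The selected candidate
  is closer to \<open>\<theta>\<^sub>0 + e\<close> than every other \<open>\<xi>\<^sub>S\<close>; expanding the squares shows that its squared error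
  is at most \<open>4 \<parallel>\<xi>\<^sub>S - \<theta>\<^sub>0\<parallel>\<^sup>2 + 6 Z\<^sup>2\<close>, where \<open>Z\<close> is any bound on the component of \<open>e\<close> along
  the directions \<open>\<xi>\<^sub>T - \<xi>\<^sub>S\<close> (\<open>selection_comparison\<close>, \<open>ms_risk\<close>). There are two choices of \<open>Z\<close>.
  The norm of \<open>e\<close> has second moment of order \<open>d \<tau>\<^sup>2 / n\<^sub>0\<close> (\<open>ms_risk_dimension\<close>). The largest of the
  \<open>2\<^sup>m\<close> components has, since the candidates are independent of \<open>e\<close> and \<open>ln (2\<^sup>m) \<le> m\<close>, second
  moment of order \<open>m \<tau>\<^sup>2 / n\<^sub>0\<close> (\<open>ms_risk_selection\<close>).

  The tail condition does not force the noise to be centred, so averaging does not remove all of it.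
  But it bounds the noise in every single direction, whence the bias of an estimator of sample size
  \<open>s\<close> has squared norm of order \<open>\<tau>\<^sup>2 / s\<close>, without a factor \<open>d\<close>. A weighted mean of total sample
  size \<open>N\<close> over \<open>r\<close> estimators thus has squared error of order \<open>(d + r) \<tau>\<^sup>2 / N\<close>: variance plus
  squared bias (\<open>precision_weighted_mean\<close>).

  If \<open>d < m\<close>, compare with the candidate that uses no source and take \<open>Z = \<parallel>e\<parallel>\<close>: the risk is of
  order \<open>d \<tau>\<^sup>2 / n\<^sub>0\<close>, whereas the oracle rate is at least \<open>d \<tau>\<^sup>2 / (n\<^sub>0 + m n)\<close>, so the ratio is
  of order \<open>m n / n\<^sub>0\<close> once \<open>n\<^sub>0 \<le> m n\<close>. If \<open>m \<le> d\<close>, compare with the subset attaining the oracle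
  rate, where \<open>d + r\<close> is of order \<open>d\<close> and the candidate has the oracle rate; the selection adds
  \<open>m \<tau>\<^sup>2 / n\<^sub>0\<close>, which is of order \<open>(m / d) (m n / n\<^sub>0)\<close> times the oracle rate
  (\<open>ms_risk_le_oracle_rate\<close>).
\<close>

section \<open>Selecting the closest candidate\<close>

text \<open>
  Comparing the distances of \<open>q\<close> and \<open>p\<close> to \<open>y\<close> gives
  \<open>\<parallel>q - c\<parallel>\<^sup>2 \<le> \<parallel>p - c\<parallel>\<^sup>2 + 2 \<langle>q - p, y - c\<rangle>\<close>, and the cross term is linear in \<open>\<parallel>q - c\<parallel>\<close>,
  so it can be absorbed into the left-hand side.
\<close>

lemma selection_comparison:
  fixes p q y c :: "'i \<Rightarrow> real"
  assumes fin: "finite I"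
    and closer: "(L2_set (\<lambda>i. q i - y i) I)\<^sup>2 \<le> (L2_set (\<lambda>i. p i - y i) I)\<^sup>2"
    and noise: "(\<Sum>i\<in>I. (q i - p i) * (y i - c i)) \<le> z * L2_set (\<lambda>i. q i - p i) I"
    and z: "z \<ge> 0"
  shows "(L2_set (\<lambda>i. q i - c i) I)\<^sup>2 \<le> 4 * (L2_set (\<lambda>i. p i - c i) I)\<^sup>2 + 6 * z\<^sup>2"
proof -
  let ?r = "L2_set (\<lambda>i. q i - c i) I" and ?a = "L2_set (\<lambda>i. p i - c i) I"
  have sq: "(L2_set f I)\<^sup>2 = (\<Sum>i\<in>I. (f i)\<^sup>2)" for f :: "'i \<Rightarrow> real"
    unfolding L2_set_def by (simp add: sum_nonneg)
  have "(\<Sum>i\<in>I. (p i - y i)\<^sup>2) - (\<Sum>i\<in>I. (q i - y i)\<^sup>2)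
      = (\<Sum>i\<in>I. (p i - c i)\<^sup>2) - (\<Sum>i\<in>I. (q i - c i)\<^sup>2)
        + 2 * (\<Sum>i\<in>I. (q i - p i) * (y i - c i))"
    unfolding sum_distrib_left sum_subtractf[symmetric] sum.distrib[symmetric]
    by (intro sum.cong) (auto simp: power2_eq_square algebra_simps)
  then have 1: "?r\<^sup>2 \<le> ?a\<^sup>2 + 2 * (z * L2_set (\<lambda>i. q i - p i) I)"
    using closer noise unfolding sq by linarith
  have "L2_set (\<lambda>i. q i - p i) I \<le> ?r + ?a"
    using L2_set_triangle_ineq[of "\<lambda>i. q i - c i" "\<lambda>i. c i - p i" I]
    by (simp add: L2_set_def power2_commute)
  then have "z * L2_set (\<lambda>i. q i - p i) I \<le> z * (?r + ?a)"
    using z by (rule mult_left_mono)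
  then have "?r\<^sup>2 \<le> ?a\<^sup>2 + 2 * (z * (?r + ?a))" using 1 by linarith
  \<comment> \<open>the two squares absorb \<open>2 z r\<close> and \<open>2 z a\<close>\<close>
  moreover have "0 \<le> (?r - 2 * z)\<^sup>2" "0 \<le> (?a - z)\<^sup>2" by simp_all
  ultimately show ?thesis by (simp add: power2_eq_square algebra_simps)
qed

section \<open>Moments from sub-Gaussian tails\<close>

text \<open>
  A discrete layer-cake bound: \<open>X / u - r - 1\<close> is at most the number of levels \<open>k \<ge> 1\<close> that
  \<open>X / u - r\<close> exceeds. The offset \<open>r\<close> is meant for maxima of about \<open>exp r\<close> variables, whose tails
  become small only beyond the level \<open>r\<close>; the events \<open>A k\<close> are then unions.
\<close>

lemma (in prob_space) nn_integral_le_from_level_tails: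
  fixes X :: "'a \<Rightarrow> real"
  assumes u: "u > 0" and r: "r \<ge> 0" and c: "c \<ge> 0"
    and A: "\<And>k. A k \<in> events"
    and level: "\<And>x k. x \<in> space M \<Longrightarrow> k \<ge> 1 \<Longrightarrow> X x > u * (r + real k) \<Longrightarrow> x \<in> A k"
    and tail: "\<And>k. k \<ge> 1 \<Longrightarrow> prob (A k) \<le> c * exp (- real k)"
  shows "(\<integral>\<^sup>+x. ennreal (X x) \<partial>M) \<le> ennreal (u * (r + 1 + c))"
proof -
  have point: "ennreal (X x) \<le> ennreal (u * (r + 1)) + (\<Sum>k. ennreal u * indicator (A (Suc k)) x)"
    if x: "x \<in> space M" for x
  proof (cases "X x \<le> u * (r + 1)")
    case True
    then show ?thesis by (meson add_increasing2 ennreal_leI zero_le)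
  next
    case False
    define q where "q = X x / u - r"
    define N where "N = nat (\<lceil>q\<rceil> - 1)"
    have q1: "q > 1" using False u by (simp add: q_def field_simps)
    then have N: "real N < q" "q \<le> real N + 1" unfolding N_def by linarith+
    have in_A: "x \<in> A (Suc k)" if "k < N" for k
    proof (rule level[OF x])
      have "real (Suc k) < q" using that N by linarith
      then show "X x > u * (r + real (Suc k))" using u by (simp add: q_def field_simps)
    qed simp
    have "X x = u * (r + q)" using u by (simp add: q_def)
    also have "\<dots> \<le> u * (r + 1) + real N * u"
      using mult_left_mono[OF N(2), of u] u by (simp add: algebra_simps)
    finally have "ennreal (X x) \<le> ennreal (u * (r + 1) + real N * u)" by (rule ennreal_leI)
    also have "\<dots> = ennreal (u * (r + 1)) + of_nat N * ennreal u"
      using u r by (simp add: ennreal_plus ennreal_mult ennreal_of_nat_eq_real_of_nat)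
    also have "of_nat N * ennreal u = (\<Sum>k<N. ennreal u * indicator (A (Suc k)) x)"
      using in_A by simp
    also have "\<dots> \<le> (\<Sum>k. ennreal u * indicator (A (Suc k)) x)"
      by (rule sum_le_suminf) auto
    finally show ?thesis by (simp add: add_left_mono)
  qed
  have [measurable]: "A k \<in> events" for k by (rule A)
  have half: "exp (- real (Suc k)) \<le> (1/2) ^ Suc k" for k
  proof -
    have "exp (-1) \<le> (1/2 :: real)" using exp_ge_add_one_self[of 1] by (simp add: exp_minus field_simps)
    then have "exp (-1) ^ Suc k \<le> (1/2 :: real) ^ Suc k" by (intro power_mono) auto
    then show ?thesis by (simp only: exp_of_nat_mult[symmetric]) simp
  qed
  have "(\<integral>\<^sup>+x. ennreal (X x) \<partial>M)
      \<le> (\<integral>\<^sup>+x. ennreal (u * (r + 1)) + (\<Sum>k. ennreal u * indicator (A (Suc k)) x) \<partial>M)"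
    by (intro nn_integral_mono point)
  also have "\<dots> = ennreal (u * (r + 1)) + (\<Sum>k. ennreal u * emeasure M (A (Suc k)))"
    by (simp add: nn_integral_add nn_integral_suminf nn_integral_cmult emeasure_space_1)
  also have "(\<Sum>k. ennreal u * emeasure M (A (Suc k))) \<le> (\<Sum>k. ennreal (u * c * (1/2) ^ Suc k))"
  proof (intro suminf_le allI summableI)
    fix k
    have "prob (A (Suc k)) \<le> c * (1/2) ^ Suc k"
      using tail[of "Suc k"] mult_left_mono[OF half[of k] c] by simp
    then have "u * prob (A (Suc k)) \<le> u * (c * (1/2) ^ Suc k)" using u by (intro mult_left_mono) auto
    then show "ennreal u * emeasure M (A (Suc k)) \<le> ennreal (u * c * (1/2) ^ Suc k)"
      unfolding emeasure_eq_measure using u by (simp add: ennreal_mult[symmetric] ennreal_leI mult.assoc)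
  qed
  also have "(\<Sum>k. ennreal (u * c * (1/2) ^ Suc k)) = ennreal (u * c)"
    using sums_mult[OF power_half_series, of "u * c"] u c
    by (intro suminf_ennreal_eq) auto
  finally show ?thesis using u r c by (simp add: ennreal_plus[symmetric] algebra_simps del: ennreal_plus)
qed

lemma L2_set_normalized: "L2_set f I \<noteq> 0 \<Longrightarrow> L2_set (\<lambda>i. f i / L2_set f I) I = 1"
  using L2_set_left_distrib[of "inverse (L2_set f I)" f I]
  by (simp add: divide_inverse L2_set_nonneg)

text \<open>
  As \<open>- a\<close> is a unit vector along with \<open>a\<close>, the one-sided bounds control both tails. They allow a
  nonzero mean.
\<close>

definition sub_gaussian ::
  "real \<Rightarrow> real \<Rightarrow> real \<Rightarrow> nat \<Rightarrow> 'a measure \<Rightarrow> ('a \<Rightarrow> nat \<Rightarrow> real) \<Rightarrow> bool" where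
  "sub_gaussian c s \<sigma> d M \<epsilon> \<longleftrightarrow>
     (\<forall>i<d. (\<lambda>x. \<epsilon> x i) \<in> borel_measurable M) \<and>
     (\<forall>a t. L2_set a {..<d} = 1 \<longrightarrow> t > 0 \<longrightarrow>
        measure M {x \<in> space M. (\<Sum>i<d. a i * \<epsilon> x i) > t} \<le> c * exp (- s * t\<^sup>2 / (2 * \<sigma>\<^sup>2)))"

context prob_space
begin

context
  fixes c s \<sigma> :: real and d :: nat and \<epsilon> :: "'a \<Rightarrow> nat \<Rightarrow> real"
  assumes c: "c > 0" and s: "s > 0" and \<sigma>: "\<sigma> > 0" and sg: "sub_gaussian c s \<sigma> d M \<epsilon>"
begin

lemma sub_gaussian_measurable [measurable]: "i < d \<Longrightarrow> (\<lambda>x. \<epsilon> x i) \<in> borel_measurable M"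
  using sg by (simp add: sub_gaussian_def)

lemma sub_gaussian_direction_nn:
  assumes a: "L2_set a {..<d} = 1"
  shows "(\<integral>\<^sup>+x. ennreal ((\<Sum>i<d. a i * \<epsilon> x i)\<^sup>2) \<partial>M) \<le> ennreal ((2 + 4 * c) * \<sigma>\<^sup>2 / s)"
proof -
  \<comment> \<open>chosen so that the tail bound at \<open>sqrt (u k)\<close> is \<open>c * exp (- k)\<close>\<close>
  define u where "u = 2 * \<sigma>\<^sup>2 / s"
  have u: "u > 0" using \<sigma> s by (simp add: u_def)
  let ?Y = "\<lambda>x. \<Sum>i<d. a i * \<epsilon> x i"
  have [measurable]: "?Y \<in> borel_measurable M" by measurable
  define P where "P k = {x \<in> space M. (\<Sum>i<d. a i * \<epsilon> x i) > sqrt (u * real k)}" for k :: nat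
  define N where "N k = {x \<in> space M. (\<Sum>i<d. (- a i) * \<epsilon> x i) > sqrt (u * real k)}" for k :: nat
  have PN: "P k \<in> events" "N k \<in> events" for k
    unfolding P_def N_def by (simp_all add: sum_negf)
  have exponent: "- s * (sqrt (u * real k))\<^sup>2 / (2 * \<sigma>\<^sup>2) = - real k" for k :: nat
    using u s \<sigma> by (simp add: u_def)
  have tail: "prob {x \<in> space M. (\<Sum>i<d. b i * \<epsilon> x i) > sqrt (u * real k)} \<le> c * exp (- real k)"
    if "L2_set b {..<d} = 1" "k \<ge> 1" for b and k :: nat
  proof -
    have "sqrt (u * real k) > 0" using u that by simp
    with sg that(1) have "prob {x \<in> space M. (\<Sum>i<d. b i * \<epsilon> x i) > sqrt (u * real k)}
        \<le> c * exp (- s * (sqrt (u * real k))\<^sup>2 / (2 * \<sigma>\<^sup>2))"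
      unfolding sub_gaussian_def by blast
    then show ?thesis unfolding exponent .
  qed
  have "L2_set (\<lambda>i. - a i) {..<d} = 1" using a by (simp add: L2_set_def)
  then have tails: "prob (P k) \<le> c * exp (- real k)" "prob (N k) \<le> c * exp (- real k)" if "k \<ge> 1" for k
    unfolding P_def N_def by (intro tail a that)+
  have "(\<integral>\<^sup>+x. ennreal ((?Y x)\<^sup>2) \<partial>M) \<le> ennreal (u * (0 + 1 + 2 * c))"
  proof (rule nn_integral_le_from_level_tails[where A = "\<lambda>k. P k \<union> N k"])
    fix x k assume x: "x \<in> space M" "(?Y x)\<^sup>2 > u * (0 + real k)"
    then have "sqrt (u * real k) < \<bar>?Y x\<bar>" using real_sqrt_less_mono by fastforce
    then show "x \<in> P k \<union> N k" using x(1) by (auto simp: P_def N_def sum_negf abs_if split: if_splits)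
  next
    fix k :: nat assume "k \<ge> 1"
    then show "prob (P k \<union> N k) \<le> 2 * c * exp (- real k)"
      using tails[of k] measure_Un_le[OF PN, of k k] by linarith
  qed (use u c PN in auto)
  then show ?thesis by (simp add: u_def algebra_simps)
qed

lemma sub_gaussian_direction:
  assumes a: "L2_set a {..<d} = 1"
  shows "integrable M (\<lambda>x. (\<Sum>i<d. a i * \<epsilon> x i)\<^sup>2)"
    and "expectation (\<lambda>x. (\<Sum>i<d. a i * \<epsilon> x i)\<^sup>2) \<le> (2 + 4 * c) * \<sigma>\<^sup>2 / s"
proof -
  note le = sub_gaussian_direction_nn[OF a]
  show 1: "integrable M (\<lambda>x. (\<Sum>i<d. a i * \<epsilon> x i)\<^sup>2)"
    using le by (intro integrableI_nonneg) (auto intro: le_less_trans)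
  show "expectation (\<lambda>x. (\<Sum>i<d. a i * \<epsilon> x i)\<^sup>2) \<le> (2 + 4 * c) * \<sigma>\<^sup>2 / s"
    using le c s by (subst (asm) nn_integral_eq_integral[OF 1]) auto
qed

lemma sub_gaussian_coordinate:
  assumes i: "i < d"
  shows "integrable M (\<lambda>x. (\<epsilon> x i)\<^sup>2)"
    and "expectation (\<lambda>x. (\<epsilon> x i)\<^sup>2) \<le> (2 + 4 * c) * \<sigma>\<^sup>2 / s"
    and "integrable M (\<lambda>x. \<epsilon> x i)"
proof -
  have unit: "L2_set (\<lambda>j. if j = i then 1 else 0) {..<d} = 1"
    using i by (simp add: L2_set_def if_distrib[of "\<lambda>x. x\<^sup>2"] cong: if_cong)
  have "(\<Sum>j<d. (if j = i then 1 else 0) * \<epsilon> x j) = \<epsilon> x i" for x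
    using i by (simp add: if_distrib[of "\<lambda>y. y * _"] cong: if_cong)
  then show 1: "integrable M (\<lambda>x. (\<epsilon> x i)\<^sup>2)"
    and "expectation (\<lambda>x. (\<epsilon> x i)\<^sup>2) \<le> (2 + 4 * c) * \<sigma>\<^sup>2 / s"
    using sub_gaussian_direction[OF unit] by simp_all
  show "integrable M (\<lambda>x. \<epsilon> x i)"
    by (rule square_integrable_imp_integrable[OF _ 1]) (use i in measurable)
qed

text \<open>
  The mean vector is tested against its own direction: its length is the mean of one coordinate of
  the noise, so the dimension does not enter.
\<close>

lemma sub_gaussian_bias:
  "(\<Sum>i<d. (expectation (\<lambda>x. \<epsilon> x i))\<^sup>2) \<le> (2 + 4 * c) * \<sigma>\<^sup>2 / s"
proof -
  define \<beta> where "\<beta> i = expectation (\<lambda>x. \<epsilon> x i)" for i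
  define l where "l = L2_set \<beta> {..<d}"
  have l2: "l\<^sup>2 = (\<Sum>i<d. (\<beta> i)\<^sup>2)" by (simp add: l_def L2_set_def sum_nonneg)
  show ?thesis
  proof (cases "l = 0")
    case True
    then show ?thesis using l2 c s by (simp add: \<beta>_def)
  next
    case False
    then have l: "l > 0" using L2_set_nonneg[of \<beta> "{..<d}"] unfolding l_def by linarith
    define a where "a i = \<beta> i / l" for i
    have a: "L2_set a {..<d} = 1" 
      using L2_set_normalized[of \<beta> "{..<d}"] False unfolding a_def[abs_def] l_def by blast
    have int: "integrable M (\<lambda>x. \<Sum>i<d. a i * \<epsilon> x i)"
      using sub_gaussian_coordinate(3) by (intro Bochner_Integration.integrable_sum integrable_mult_right) auto
    have "expectation (\<lambda>x. \<Sum>i<d. a i * \<epsilon> x i) = (\<Sum>i<d. a i * \<beta> i)"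
      using sub_gaussian_coordinate(3) by (simp add: Bochner_Integration.integral_sum \<beta>_def)
    also have "\<dots> = l"
      using l l2 by (simp add: a_def sum_divide_distrib[symmetric] power2_eq_square[symmetric] field_simps)
    finally have "expectation (\<lambda>x. \<Sum>i<d. a i * \<epsilon> x i) = l" .
    then have "l\<^sup>2 \<le> expectation (\<lambda>x. (\<Sum>i<d. a i * \<epsilon> x i)\<^sup>2)"
      using variance_eq[OF int sub_gaussian_direction(1)[OF a]]
        variance_positive[of "\<lambda>x. \<Sum>i<d. a i * \<epsilon> x i"] by simp
    also have "\<dots> \<le> (2 + 4 * c) * \<sigma>\<^sup>2 / s" by (rule sub_gaussian_direction(2)[OF a])
    finally show ?thesis by (simp add: l2 \<beta>_def)
  qed
qed

lemma sub_gaussian_norm: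
  "integrable M (\<lambda>x. \<Sum>i<d. (\<epsilon> x i)\<^sup>2)"
  "expectation (\<lambda>x. \<Sum>i<d. (\<epsilon> x i)\<^sup>2) \<le> real d * ((2 + 4 * c) * \<sigma>\<^sup>2 / s)"
proof -
  show "integrable M (\<lambda>x. \<Sum>i<d. (\<epsilon> x i)\<^sup>2)" using sub_gaussian_coordinate(1) by auto
  have "expectation (\<lambda>x. \<Sum>i<d. (\<epsilon> x i)\<^sup>2) = (\<Sum>i<d. expectation (\<lambda>x. (\<epsilon> x i)\<^sup>2))"
    using sub_gaussian_coordinate(1) by (intro Bochner_Integration.integral_sum) auto
  also have "\<dots> \<le> (\<Sum>i<d. (2 + 4 * c) * \<sigma>\<^sup>2 / s)"
    using sub_gaussian_coordinate(2) by (intro sum_mono) auto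
  finally show "expectation (\<lambda>x. \<Sum>i<d. (\<epsilon> x i)\<^sup>2) \<le> real d * ((2 + 4 * c) * \<sigma>\<^sup>2 / s)" by simp
qed

text \<open>
  A direction that is independent of the noise can be treated as fixed, by Fubini. Comparing with the
  length of \<open>g\<close> instead of normalising it covers \<open>g = 0\<close>, where the event is empty.
\<close>

lemma sub_gaussian_random_direction:
  fixes t :: real
  assumes t: "t > 0" and indep: "indep_var L X N Y"
    and \<epsilon>: "\<And>x i. i < d \<Longrightarrow> \<epsilon> x i = f i (Y x)"
    and f [measurable]: "\<And>i. i < d \<Longrightarrow> f i \<in> borel_measurable N"
    and g [measurable]: "\<And>i. i < d \<Longrightarrow> (\<lambda>u. g u i) \<in> borel_measurable L"
  shows "prob {x \<in> space M. (\<Sum>i<d. g (X x) i * \<epsilon> x i) > t * L2_set (g (X x)) {..<d}}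
      \<le> c * exp (- s * t\<^sup>2 / (2 * \<sigma>\<^sup>2))" (is "_ \<le> ?B")
proof -
  note rv [measurable] = indep_var_rv1[OF indep] indep_var_rv2[OF indep]
  let ?LN = "L \<Otimes>\<^sub>M N"
  define A where "A = {p \<in> space ?LN.
      (\<Sum>i<d. g (fst p) i * f i (snd p)) > t * L2_set (g (fst p)) {..<d}}"
  have A [measurable]: "A \<in> sets ?LN" unfolding A_def L2_set_def by measurable
  interpret PX: prob_space "distr M L X" by (rule prob_space_distr) measurable
  interpret PY: prob_space "distr M N Y" by (rule prob_space_distr) measurable
  have A': "A \<in> sets (distr M L X \<Otimes>\<^sub>M distr M N Y)"
    using A by (simp cong: sets_pair_measure_cong)
  have "emeasure M {x \<in> space M. (\<Sum>i<d. g (X x) i * \<epsilon> x i) > t * L2_set (g (X x)) {..<d}}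
      = emeasure M ((\<lambda>x. (X x, Y x)) -` A \<inter> space M)"
    using measurable_space[OF rv(1)] measurable_space[OF rv(2)]
    by (intro arg_cong[where f = "emeasure M"]) (auto simp: A_def space_pair_measure \<epsilon>)
  also have "\<dots> = emeasure (distr M ?LN (\<lambda>x. (X x, Y x))) A"
    by (rule emeasure_distr[symmetric]) measurable
  also have "\<dots> = emeasure (distr M L X \<Otimes>\<^sub>M distr M N Y) A"
    using indep_var_distribution_eq[THEN iffD1, OF indep] by simp
  also have "\<dots> = (\<integral>\<^sup>+u. emeasure (distr M N Y) (Pair u -` A) \<partial>distr M L X)"
    by (rule PY.emeasure_pair_measure_alt[OF A'])
  also have "\<dots> \<le> (\<integral>\<^sup>+u. ennreal ?B \<partial>distr M L X)"
  proof (rule nn_integral_mono)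
    fix u assume "u \<in> space (distr M L X)"
    then have u: "u \<in> space L" by simp
    let ?l = "L2_set (g u) {..<d}"
    have "emeasure (distr M N Y) (Pair u -` A) = emeasure M (Y -` (Pair u -` A) \<inter> space M)"
      by (intro emeasure_distr sets_Pair1[OF A]) measurable
    also have "Y -` (Pair u -` A) \<inter> space M = {x \<in> space M. (\<Sum>i<d. g u i * \<epsilon> x i) > t * ?l}"
      using u measurable_space[OF rv(2)] by (auto simp: A_def space_pair_measure \<epsilon>)
    also have "emeasure M \<dots> \<le> ennreal ?B"
    proof (cases "?l = 0")
      case True
      then have "\<forall>i<d. g u i = 0" by (simp add: L2_set_eq_0_iff)
      then have "{x \<in> space M. (\<Sum>i<d. g u i * \<epsilon> x i) > t * ?l} = {}" using True by simp
      then show ?thesis by (simp only: emeasure_empty zero_le)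
    next
      case False
      then have l: "?l > 0" using L2_set_nonneg[of "g u" "{..<d}"] by linarith
      define a where "a i = g u i / ?l" for i
      have a: "L2_set a {..<d} = 1" 
        using L2_set_normalized[of "g u" "{..<d}"] False unfolding a_def[abs_def] by blast
      have "(\<Sum>i<d. a i * \<epsilon> x i) = (\<Sum>i<d. g u i * \<epsilon> x i) / ?l" for x
        by (simp add: a_def sum_divide_distrib)
      then have "{x \<in> space M. (\<Sum>i<d. g u i * \<epsilon> x i) > t * ?l} = {x \<in> space M. (\<Sum>i<d. a i * \<epsilon> x i) > t}"
        using l by (simp add: pos_less_divide_eq)
      then show ?thesis
        using sg a t unfolding emeasure_eq_measure sub_gaussian_def by (simp add: ennreal_leI)
    qed
    finally show "emeasure (distr M N Y) (Pair u -` A) \<le> ennreal ?B" .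
  qed
  also have "\<dots> = ennreal ?B" using PX.emeasure_space_1 by simp
  finally show ?thesis using c by (simp add: emeasure_eq_measure)
qed

end

text \<open>
  Expanding the square, the diagonal terms give the variance part \<open>d K / N\<close>. An off-diagonal term is,
  by independence, an inner product of two bias vectors, so that these terms add up to at most
  \<open>(\<Sum> w \<rho>)\<^sup>2\<close> with \<open>\<rho> = sqrt (K / s)\<close>, which Cauchy--Schwarz bounds by \<open>K card B / N\<close>.
\<close>

lemma precision_weighted_mean:
  fixes \<epsilon> :: "'b \<Rightarrow> 'a \<Rightarrow> nat \<Rightarrow> real" and s :: "'b \<Rightarrow> real" and c \<sigma> :: real
  assumes fin: "finite B" "B \<noteq> {}" and c: "c > 0" and \<sigma>: "\<sigma> > 0"
    and s: "\<And>b. b \<in> B \<Longrightarrow> s b > 0"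
    and sg: "\<And>b. b \<in> B \<Longrightarrow> sub_gaussian c (s b) \<sigma> d M (\<epsilon> b)"
    and indep: "\<And>i. i < d \<Longrightarrow> indep_vars (\<lambda>_. borel) (\<lambda>b x. \<epsilon> b x i) B"
  defines "K \<equiv> (2 + 4 * c) * \<sigma>\<^sup>2" and "N \<equiv> \<Sum>b\<in>B. s b"
  shows "(\<integral>\<^sup>+x. ennreal (\<Sum>i<d. (\<Sum>b\<in>B. s b / N * \<epsilon> b x i)\<^sup>2) \<partial>M)
    \<le> ennreal (K * (real d + real (card B)) / N)"
proof -
  define w where "w b = s b / N" for b
  define \<beta> where "\<beta> b i = expectation (\<lambda>x. \<epsilon> b x i)" for b i
  define \<rho> where "\<rho> b = sqrt (K / s b)" for b
  have K: "K > 0" using c \<sigma> by (simp add: K_def)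
  have N: "N > 0" unfolding N_def using fin s by (intro sum_pos) auto
  have w: "w b \<ge> 0" if "b \<in> B" for b using s[OF that] N by (simp add: w_def)
  note coord = sub_gaussian_coordinate[OF c s \<sigma> sg]
  have pair: "integrable M (\<lambda>x. \<epsilon> b x i * \<epsilon> b' x i)"
    "expectation (\<lambda>x. \<epsilon> b x i * \<epsilon> b' x i) = \<beta> b i * \<beta> b' i"
    if "b \<in> B" "b' \<in> B" "b \<noteq> b'" "i < d" for b b' i
  proof -
    have "indep_vars (\<lambda>_. borel) (\<lambda>b x. \<epsilon> b x i) {b, b'}"
      using that by (intro indep_vars_subset[OF indep]) auto
    moreover have "integrable M (\<lambda>x. \<epsilon> e x i)" if "e \<in> {b, b'}" for e
      using that \<open>b \<in> B\<close> \<open>b' \<in> B\<close> \<open>i < d\<close> coord(3) by blast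
    ultimately show "integrable M (\<lambda>x. \<epsilon> b x i * \<epsilon> b' x i)"
      "expectation (\<lambda>x. \<epsilon> b x i * \<epsilon> b' x i) = \<beta> b i * \<beta> b' i"
      using indep_vars_integrable[of "{b, b'}" "\<lambda>b x. \<epsilon> b x i"]
        indep_vars_lebesgue_integral[of "{b, b'}" "\<lambda>b x. \<epsilon> b x i"] \<open>b \<noteq> b'\<close>
      by (simp_all add: \<beta>_def)
  qed
  have int: "integrable M (\<lambda>x. \<epsilon> b x i * \<epsilon> b' x i)" if "b \<in> B" "b' \<in> B" "i < d" for b b' i
    using pair(1)[of b b' i] coord(1)[of b i] that by (cases "b = b'") (auto simp: power2_eq_square)
  have bias: "L2_set (\<beta> b) {..<d} \<le> \<rho> b" if "b \<in> B" for b
    using sub_gaussian_bias[OF c s[OF that] \<sigma> sg[OF that]]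
    by (simp add: L2_set_def \<rho>_def K_def \<beta>_def)
  define G where "G b b' = (\<Sum>i<d. expectation (\<lambda>x. \<epsilon> b x i * \<epsilon> b' x i))" for b b'
  have G: "G b b' \<le> (if b = b' then real d * K / s b else 0) + \<rho> b * \<rho> b'"
    if b: "b \<in> B" "b' \<in> B" for b b'
  proof (cases "b = b'")
    case True
    have "G b b' \<le> (\<Sum>i<d. K / s b)"
      unfolding G_def using coord(2)[of b] b True by (intro sum_mono) (auto simp: K_def power2_eq_square)
    moreover have "0 \<le> \<rho> b * \<rho> b'" using True by simp
    ultimately show ?thesis unfolding if_P[OF True] by simp
  next
    case False
    have "G b b' = (\<Sum>i<d. \<beta> b i * \<beta> b' i)"
      unfolding G_def using pair(2) b False by (intro sum.cong) auto
    also have "\<dots> \<le> (\<Sum>i<d. \<bar>\<beta> b i\<bar> * \<bar>\<beta> b' i\<bar>)"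
      by (intro sum_mono) (simp add: abs_mult[symmetric])
    also have "\<dots> \<le> L2_set (\<beta> b) {..<d} * L2_set (\<beta> b') {..<d}" by (rule L2_set_mult_ineq)
    also have "\<dots> \<le> \<rho> b * \<rho> b'"
      using b bias K s by (intro mult_mono) (auto simp: L2_set_nonneg \<rho>_def less_imp_le)
    finally show ?thesis using False by simp
  qed
  have expand: "(\<Sum>i<d. (\<Sum>b\<in>B. w b * \<epsilon> b x i)\<^sup>2)
      = (\<Sum>b\<in>B. \<Sum>b'\<in>B. w b * w b' * (\<Sum>i<d. \<epsilon> b x i * \<epsilon> b' x i))" for x
  proof -
    have "(\<Sum>i<d. (\<Sum>b\<in>B. w b * \<epsilon> b x i)\<^sup>2)
        = (\<Sum>i<d. \<Sum>b\<in>B. \<Sum>b'\<in>B. w b * w b' * (\<epsilon> b x i * \<epsilon> b' x i))"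
      by (simp add: power2_eq_square sum_product ac_simps)
    also have "\<dots> = (\<Sum>b\<in>B. \<Sum>i<d. \<Sum>b'\<in>B. w b * w b' * (\<epsilon> b x i * \<epsilon> b' x i))"
      by (rule sum.swap)
    also have "\<dots> = (\<Sum>b\<in>B. \<Sum>b'\<in>B. \<Sum>i<d. w b * w b' * (\<epsilon> b x i * \<epsilon> b' x i))"
      by (intro sum.cong refl sum.swap)
    finally show ?thesis by (simp add: sum_distrib_left)
  qed
  have int_sum: "integrable M (\<lambda>x. w b * w b' * (\<Sum>i<d. \<epsilon> b x i * \<epsilon> b' x i))"
    if "b \<in> B" "b' \<in> B" for b b'
    using int that by (intro integrable_mult_right Bochner_Integration.integrable_sum) auto
  have int_all: "integrable M (\<lambda>x. \<Sum>i<d. (\<Sum>b\<in>B. w b * \<epsilon> b x i)\<^sup>2)"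
    unfolding expand by (intro Bochner_Integration.integrable_sum int_sum)
  have "expectation (\<lambda>x. \<Sum>i<d. (\<Sum>b\<in>B. w b * \<epsilon> b x i)\<^sup>2) = (\<Sum>b\<in>B. \<Sum>b'\<in>B. w b * w b' * G b b')"
  proof -
    have "expectation (\<lambda>x. \<Sum>i<d. \<epsilon> b x i * \<epsilon> b' x i) = G b b'" if "b \<in> B" "b' \<in> B" for b b'
      unfolding G_def using int that by (intro Bochner_Integration.integral_sum) auto
    moreover have "expectation (\<lambda>x. \<Sum>b\<in>B. \<Sum>b'\<in>B. w b * w b' * (\<Sum>i<d. \<epsilon> b x i * \<epsilon> b' x i))
        = (\<Sum>b\<in>B. \<Sum>b'\<in>B. expectation (\<lambda>x. w b * w b' * (\<Sum>i<d. \<epsilon> b x i * \<epsilon> b' x i)))"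
      using int_sum by (simp only: Bochner_Integration.integral_sum Bochner_Integration.integrable_sum
          cong: sum.cong)
    ultimately show ?thesis unfolding expand by simp
  qed
  also have "\<dots> \<le> (\<Sum>b\<in>B. \<Sum>b'\<in>B. w b * w b' * ((if b = b' then real d * K / s b else 0) + \<rho> b * \<rho> b'))"
    using G w by (intro sum_mono mult_left_mono) auto
  also have "\<dots> = (\<Sum>b\<in>B. (w b)\<^sup>2 * (real d * K / s b)) + (\<Sum>b\<in>B. w b * \<rho> b)\<^sup>2"
    using fin by (simp add: distrib_left sum.distrib if_distrib[of "\<lambda>z. _ * z"] sum.delta
        power2_eq_square sum_product ac_simps cong: if_cong)
  also have "(\<Sum>b\<in>B. (w b)\<^sup>2 * (real d * K / s b)) = (\<Sum>b\<in>B. s b * (real d * K / N\<^sup>2))"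
    using s by (intro sum.cong) (auto simp: w_def power2_eq_square)
  also have "\<dots> = real d * K / N"
    using N unfolding sum_distrib_right[symmetric] N_def[symmetric] by (simp add: power2_eq_square)
  also have "(\<Sum>b\<in>B. w b * \<rho> b)\<^sup>2 \<le> (\<Sum>b\<in>B. (w b * \<rho> b)\<^sup>2) * real (card B)"
    by (rule sum_squared_le_sum_of_squares)
  also have "(\<Sum>b\<in>B. (w b * \<rho> b)\<^sup>2) = (\<Sum>b\<in>B. s b * (K / N\<^sup>2))"
  proof (intro sum.cong refl)
    fix b assume "b \<in> B"
    then have \<rho>2: "(\<rho> b)\<^sup>2 = K / s b" and "s b > 0" using s K by (auto simp: \<rho>_def less_imp_le)
    then show "(w b * \<rho> b)\<^sup>2 = s b * (K / N\<^sup>2)"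
      unfolding power_mult_distrib \<rho>2 w_def by (simp add: power2_eq_square)
  qed
  also have "\<dots> = K / N"
    using N unfolding sum_distrib_right[symmetric] N_def[symmetric] by (simp add: power2_eq_square)
  finally have "expectation (\<lambda>x. \<Sum>i<d. (\<Sum>b\<in>B. w b * \<epsilon> b x i)\<^sup>2) \<le> K * (real d + real (card B)) / N"
    by (simp add: add_divide_distrib distrib_left mult.commute)
  then show ?thesis
    unfolding w_def[symmetric]
    by (subst nn_integral_eq_integral[OF int_all]) (auto intro!: ennreal_leI sum_nonneg)
qed

end

section \<open>Risk of the model-selection estimator\<close>

lemma L2_set_sum_le:
  assumes "\<And>b. b \<in> B \<Longrightarrow> w b \<ge> 0"
  shows "L2_set (\<lambda>i. \<Sum>b\<in>B. w b * v b i) I \<le> (\<Sum>b\<in>B. w b * L2_set (v b) I)"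
  using assms
proof (induction B rule: infinite_finite_induct)
  case (insert b B)
  have "L2_set (\<lambda>i. \<Sum>b\<in>insert b B. w b * v b i) I
      = L2_set (\<lambda>i. w b * v b i + (\<Sum>b\<in>B. w b * v b i)) I"
    using insert by simp
  also have "\<dots> \<le> L2_set (\<lambda>i. w b * v b i) I + L2_set (\<lambda>i. \<Sum>b\<in>B. w b * v b i) I"
    by (rule L2_set_triangle_ineq)
  also have "\<dots> \<le> w b * L2_set (v b) I + (\<Sum>b\<in>B. w b * L2_set (v b) I)"
    using insert by (intro add_mono) (auto simp: L2_set_right_distrib)
  finally show ?case using insert by simp
qed (simp_all add: L2_set_def)

lemma ms_candidate_measurable:
  assumes "Half2 \<in> D" "Source ` S \<subseteq> D" "i < d"
  shows "(\<lambda>x. ms_candidate d n S x i) \<in> borel_measurable (data_space D d)"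
proof -
  have "(\<lambda>x. ((\<Sum>k\<in>S. real (n k) * x (Source k) i) + real (n 0) / 2 * x Half2 i)
      / ((\<Sum>k\<in>S. real (n k)) + real (n 0) / 2)) \<in> borel_measurable (data_space D d)"
    using assms
    by (intro borel_measurable_divide borel_measurable_add borel_measurable_sum
        borel_measurable_times borel_measurable_const measurable_obs_coord) auto
  then show ?thesis using assms(3) by (simp add: ms_candidate_def)
qed

lemma ms_estimator_measurable:
  assumes "ms_selector d m n (Pow {1..m}) J"
  shows "ms_estimator d n J \<in> data_space (split_design m) d \<rightarrow>\<^sub>M vec_space d"
  unfolding ms_estimator_def[abs_def]
proof (rule measurable_compose_countable'[where I = "Pow {1..m}"])
  show "J \<in> data_space (split_design m) d \<rightarrow>\<^sub>M count_space (Pow {1..m})"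
    using assms by (simp add: ms_selector_def)
  fix S assume S: "S \<in> Pow {1..m}"
  have D: "Half2 \<in> split_design m" "Source ` S \<subseteq> split_design m"
    using S by (auto simp: split_design_def)
  have "(\<lambda>x. \<lambda>i\<in>{..<d}. ms_candidate d n S x i) \<in> data_space (split_design m) d \<rightarrow>\<^sub>M vec_space d"
    unfolding vec_space_def by (intro measurable_restrict ms_candidate_measurable D) simp
  moreover have "(\<lambda>i\<in>{..<d}. ms_candidate d n S x i) = ms_candidate d n S x" for x
    by (simp add: ms_candidate_def fun_eq_iff)
  ultimately show "ms_candidate d n S \<in> data_space (split_design m) d \<rightarrow>\<^sub>M vec_space d" by simp
qed (simp add: countable_finite)

text \<open>One law of the class together with parameters that witness its membership.\<close>

locale split_model = prob_space P
  for P :: "(obs \<Rightarrow> nat \<Rightarrow> real) measure" +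
  fixes C\<tau> \<tau> :: real and d m :: nat and n :: "nat \<Rightarrow> nat" and h :: "nat \<Rightarrow> real"
    and \<theta> :: "nat \<Rightarrow> nat \<Rightarrow> real"
  assumes C\<tau>: "C\<tau> > 0" and \<tau>: "\<tau> > 0" and d: "d \<ge> 1"
    and size_pos: "\<And>k. k \<le> m \<Longrightarrow> n k \<ge> 1"
    and admissible: "admissible C\<tau> d m n \<tau> (split_design m) h \<theta> P"
begin

definition noise :: "obs \<Rightarrow> (obs \<Rightarrow> nat \<Rightarrow> real) \<Rightarrow> nat \<Rightarrow> real" where
  "noise b x i = x b i - \<theta> (domain_of b) i"

text \<open>The second moment of the noise of an estimator of size \<open>s\<close> in any direction is at most \<open>K / s\<close>.\<close>

definition K where "K = (2 + 4 * C\<tau>) * \<tau>\<^sup>2"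

lemma sets_P: "sets P = sets (data_space (split_design m) d)"
  and indep_obs: "indep_vars (\<lambda>_. vec_space d) (\<lambda>b x. x b) (split_design m)"
  and shift_le: "k \<in> {1..m} \<Longrightarrow> L2_set (\<lambda>i. \<theta> k i - \<theta> 0 i) {..<d} \<le> h k"
  using admissible by (auto simp: admissible_def)

lemma space_P: "space P = space (data_space (split_design m) d)"
  using sets_P by (rule sets_eq_imp_space_eq)

lemma borel_measurable_P: "borel_measurable P = borel_measurable (data_space (split_design m) d)"
  by (rule measurable_cong_sets[OF sets_P refl])

lemma obs_size_pos: "b \<in> split_design m \<Longrightarrow> obs_size n b > 0"
  using size_pos by (auto simp: split_design_def Suc_le_eq)

lemma coordinate_measurable: "i < d \<Longrightarrow> (\<lambda>v. v i - a) \<in> borel_measurable (vec_space d)"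
  unfolding vec_space_def by (intro borel_measurable_diff measurable_component_singleton) auto

lemma Half1_in: "Half1 \<in> split_design m" by (simp add: split_design_def)

lemma noise_measurable [measurable]:
  "b \<in> split_design m \<Longrightarrow> i < d \<Longrightarrow> (\<lambda>x. noise b x i) \<in> borel_measurable P"
  unfolding noise_def borel_measurable_P by measurable

lemma candidate_measurable [measurable]:
  "S \<subseteq> {1..m} \<Longrightarrow> i < d \<Longrightarrow> (\<lambda>x. ms_candidate d n S x i) \<in> borel_measurable P"
  unfolding borel_measurable_P by (intro ms_candidate_measurable) (auto simp: split_design_def)

lemma sub_gaussian_noise:
  assumes b: "b \<in> split_design m"
  shows "sub_gaussian C\<tau> (obs_size n b) \<tau> d P (noise b)"
  using b admissible noise_measurable unfolding sub_gaussian_def admissible_def noise_def by blast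

lemma indep_noise:
  assumes "i < d"
  shows "indep_vars (\<lambda>_. borel) (\<lambda>b x. noise b x i) (split_design m)"
  unfolding noise_def
  by (rule indep_vars_compose2[OF indep_obs, where Y = "\<lambda>b v. v i - \<theta> (domain_of b) i"])
     (rule coordinate_measurable[OF assms])

text \<open>
  The weights of a candidate are the sample sizes, so its error is a precision-weighted mean of
  noises plus a convex combination of the parameter shifts, which has norm at most \<open>\<eta>\<close>.
\<close>

lemma candidate_risk:
  assumes S: "S \<subseteq> {1..m}" and \<eta>: "\<eta> \<ge> 0" "\<And>k. k \<in> S \<Longrightarrow> h k \<le> \<eta>"
  shows "(\<integral>\<^sup>+x. ennreal ((L2_set (\<lambda>i. ms_candidate d n S x i - \<theta> 0 i) {..<d})\<^sup>2) \<partial>P)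
    \<le> ennreal (2 * (K * (real d + real (card S) + 1) / ((\<Sum>k\<in>S. real (n k)) + real (n 0) / 2)) + 2 * \<eta>\<^sup>2)"
proof -
  define B where "B = insert Half2 (Source ` S)"
  define N where "N = (\<Sum>k\<in>S. real (n k)) + real (n 0) / 2"
  have finS: "finite S" using S finite_subset by blast
  have B: "finite B" "B \<noteq> {}" "B \<subseteq> split_design m" using S finS by (auto simp: B_def split_design_def)
  have sum_B: "(\<Sum>b\<in>B. f b) = (\<Sum>k\<in>S. f (Source k)) + f Half2" for f :: "obs \<Rightarrow> real"
  proof -
    have "(\<Sum>b\<in>Source ` S. f b) = (\<Sum>k\<in>S. f (Source k))"
      by (subst sum.reindex) (auto simp: inj_on_def)
    moreover have "Half2 \<notin> Source ` S" by auto
    ultimately show ?thesis using finS by (simp add: B_def add.commute)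
  qed
  have card_B: "card B = card S + 1"
    using finS by (simp add: B_def card_image inj_on_def image_iff)
  have N_eq: "(\<Sum>b\<in>B. obs_size n b) = N" by (simp add: sum_B N_def)
  have N: "N > 0" using N_eq B obs_size_pos by (metis sum_pos subsetD)
  define w where "w b = obs_size n b / N" for b
  have w: "b \<in> B \<Longrightarrow> w b \<ge> 0" for b using obs_size_pos[of b] B N by (auto simp: w_def less_imp_le)
  have w_sum: "(\<Sum>b\<in>B. w b) = 1"
    using N by (simp add: w_def sum_divide_distrib[symmetric] N_eq)
  define shift where "shift b i = \<theta> (domain_of b) i - \<theta> 0 i" for b i
  define A where "A x = (\<Sum>i<d. (\<Sum>b\<in>B. w b * noise b x i)\<^sup>2)" for x
  have shift: "L2_set (shift b) {..<d} \<le> \<eta>" if b: "b \<in> B" for b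
  proof -
    consider "b = Half2" | k where "k \<in> S" "b = Source k" using b by (auto simp: B_def)
    then show ?thesis
    proof cases
      case 1
      then show ?thesis using \<eta>(1) by (simp add: shift_def L2_set_def)
    next
      case 2
      then show ?thesis using shift_le[of k] \<eta>(2)[of k] S by (auto simp: shift_def[abs_def])
    qed
  qed
  have point: "(L2_set (\<lambda>i. ms_candidate d n S x i - \<theta> 0 i) {..<d})\<^sup>2 \<le> 2 * A x + 2 * \<eta>\<^sup>2" for x
  proof -
    let ?e = "L2_set (\<lambda>i. \<Sum>b\<in>B. w b * noise b x i) {..<d}"
    let ?s = "L2_set (\<lambda>i. \<Sum>b\<in>B. w b * shift b i) {..<d}"
    have dec: "ms_candidate d n S x i - \<theta> 0 i = (\<Sum>b\<in>B. w b * noise b x i) + (\<Sum>b\<in>B. w b * shift b i)"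
      if "i < d" for i
    proof -
      have "ms_candidate d n S x i = (\<Sum>b\<in>B. obs_size n b * x b i) / N"
        using that by (simp add: ms_candidate_def sum_B N_def)
      then have "ms_candidate d n S x i - \<theta> 0 i = (\<Sum>b\<in>B. w b * x b i) - (\<Sum>b\<in>B. w b) * \<theta> 0 i"
        by (simp add: w_def sum_divide_distrib w_sum[unfolded w_def])
      also have "\<dots> = (\<Sum>b\<in>B. w b * noise b x i) + (\<Sum>b\<in>B. w b * shift b i)"
        by (simp add: sum_distrib_right sum_subtractf[symmetric] sum.distrib[symmetric]
            noise_def shift_def algebra_simps)
      finally show ?thesis .
    qed
    have "L2_set (\<lambda>i. ms_candidate d n S x i - \<theta> 0 i) {..<d}
        = L2_set (\<lambda>i. (\<Sum>b\<in>B. w b * noise b x i) + (\<Sum>b\<in>B. w b * shift b i)) {..<d}"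
      by (rule L2_set_cong) (simp_all add: dec)
    also have "\<dots> \<le> ?e + ?s" by (rule L2_set_triangle_ineq)
    also have "?s \<le> (\<Sum>b\<in>B. w b * L2_set (shift b) {..<d})" by (rule L2_set_sum_le[OF w])
    also have "\<dots> \<le> (\<Sum>b\<in>B. w b * \<eta>)" by (intro sum_mono mult_left_mono shift w)
    also have "\<dots> = \<eta>" by (simp add: sum_distrib_right[symmetric] w_sum)
    finally have "(L2_set (\<lambda>i. ms_candidate d n S x i - \<theta> 0 i) {..<d})\<^sup>2 \<le> (?e + \<eta>)\<^sup>2"
      by (intro power_mono) auto
    also have "\<dots> \<le> 2 * ?e\<^sup>2 + 2 * \<eta>\<^sup>2"
      using sum_squares_bound[of ?e \<eta>] by (simp add: power2_sum)
    also have "?e\<^sup>2 = A x" by (simp add: L2_set_def A_def sum_nonneg)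
    finally show ?thesis .
  qed
  have A0: "A x \<ge> 0" for x by (simp add: A_def sum_nonneg)
  have [measurable]: "A \<in> borel_measurable P" 
    unfolding A_def using B(3) by (intro borel_measurable_sum borel_measurable_power
        borel_measurable_times borel_measurable_const noise_measurable) auto
  have "(\<integral>\<^sup>+x. ennreal (A x) \<partial>P) \<le> ennreal (K * (real d + real (card B)) / N)"
    unfolding A_def w_def K_def N_eq[symmetric]
    using B sub_gaussian_noise obs_size_pos C\<tau> \<tau> indep_vars_subset[OF indep_noise B(3)]
    by (intro precision_weighted_mean) auto
  then have "ennreal 2 * (\<integral>\<^sup>+x. ennreal (A x) \<partial>P) \<le> ennreal 2 * ennreal (K * (real d + real (card B)) / N)"
    by (intro mult_left_mono) auto
  moreover have "(\<integral>\<^sup>+x. ennreal ((L2_set (\<lambda>i. ms_candidate d n S x i - \<theta> 0 i) {..<d})\<^sup>2) \<partial>P)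
      \<le> (\<integral>\<^sup>+x. ennreal 2 * ennreal (A x) + ennreal (2 * \<eta>\<^sup>2) \<partial>P)"
    using point A0 by (intro nn_integral_mono) (simp add: ennreal_mult[symmetric] ennreal_plus[symmetric] ennreal_leI
        del: ennreal_plus ennreal_numeral)
  moreover have "\<dots> = ennreal 2 * (\<integral>\<^sup>+x. ennreal (A x) \<partial>P) + ennreal (2 * \<eta>\<^sup>2)"
    by (simp add: nn_integral_add nn_integral_cmult emeasure_space_1)
  ultimately have "(\<integral>\<^sup>+x. ennreal ((L2_set (\<lambda>i. ms_candidate d n S x i - \<theta> 0 i) {..<d})\<^sup>2) \<partial>P)
      \<le> ennreal 2 * ennreal (K * (real d + real (card B)) / N) + ennreal (2 * \<eta>\<^sup>2)"
    by (metis (no_types, lifting) add_right_mono order_trans)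
  also have "\<dots> = ennreal (2 * (K * (real d + real (card B)) / N) + 2 * \<eta>\<^sup>2)"
    using C\<tau> N by (simp add: ennreal_mult[symmetric] ennreal_plus[symmetric] K_def
        del: ennreal_plus ennreal_numeral)
  finally show ?thesis by (simp add: card_B N_def add_ac)
qed

context
  fixes J assumes J: "ms_selector d m n (Pow {1..m}) J"
begin

lemma selected: "x \<in> space P \<Longrightarrow> J x \<subseteq> {1..m}"
  and selected_closest: "x \<in> space P \<Longrightarrow> S \<subseteq> {1..m} \<Longrightarrow>
     (L2_set (\<lambda>i. ms_candidate d n (J x) x i - x Half1 i) {..<d})\<^sup>2
      \<le> (L2_set (\<lambda>i. ms_candidate d n S x i - x Half1 i) {..<d})\<^sup>2"
  using J unfolding ms_selector_def space_P is_arg_min_def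
  by (blast, meson PowI not_less)

text \<open>
  The bound \<open>z\<close> has to serve all subsets \<open>T\<close>, because the selected one depends on the same noise.
\<close>

lemma ms_risk:
  assumes S: "S \<subseteq> {1..m}" and z [measurable]: "z \<in> borel_measurable P"
    and z_nonneg: "\<And>x. x \<in> space P \<Longrightarrow> z x \<ge> 0"
    and noise_le: "\<And>x T. x \<in> space P \<Longrightarrow> T \<subseteq> {1..m} \<Longrightarrow>
      (\<Sum>i<d. (ms_candidate d n T x i - ms_candidate d n S x i) * noise Half1 x i)
        \<le> z x * L2_set (\<lambda>i. ms_candidate d n T x i - ms_candidate d n S x i) {..<d}"
  shows "(\<integral>\<^sup>+x. ennreal ((L2_set (\<lambda>i. ms_estimator d n J x i - \<theta> 0 i) {..<d})\<^sup>2) \<partial>P)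
    \<le> 4 * (\<integral>\<^sup>+x. ennreal ((L2_set (\<lambda>i. ms_candidate d n S x i - \<theta> 0 i) {..<d})\<^sup>2) \<partial>P)
      + 6 * (\<integral>\<^sup>+x. ennreal ((z x)\<^sup>2) \<partial>P)"
proof -
  let ?a = "\<lambda>x. (L2_set (\<lambda>i. ms_candidate d n S x i - \<theta> 0 i) {..<d})\<^sup>2"
  have [measurable]: "?a \<in> borel_measurable P" unfolding L2_set_def using S by measurable
  have "(L2_set (\<lambda>i. ms_estimator d n J x i - \<theta> 0 i) {..<d})\<^sup>2 \<le> 4 * ?a x + 6 * (z x)\<^sup>2"
    if x: "x \<in> space P" for x
    unfolding ms_estimator_def
    using selected[OF x] selected_closest[OF x S] noise_le[OF x, of "J x"] z_nonneg[OF x]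
    by (intro selection_comparison[where y = "x Half1"]) (auto simp: noise_def)
  then have "(\<integral>\<^sup>+x. ennreal ((L2_set (\<lambda>i. ms_estimator d n J x i - \<theta> 0 i) {..<d})\<^sup>2) \<partial>P)
    \<le> (\<integral>\<^sup>+x. ennreal 4 * ennreal (?a x) + ennreal 6 * ennreal ((z x)\<^sup>2) \<partial>P)"
    by (intro nn_integral_mono)
       (simp add: ennreal_mult[symmetric] ennreal_plus[symmetric] ennreal_leI del: ennreal_plus ennreal_numeral)
  also have "\<dots> = 4 * (\<integral>\<^sup>+x. ennreal (?a x) \<partial>P) + 6 * (\<integral>\<^sup>+x. ennreal ((z x)\<^sup>2) \<partial>P)"
    by (simp add: nn_integral_add nn_integral_cmult)
  finally show ?thesis .
qed

lemma ms_risk_dimension: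
  assumes S: "S \<subseteq> {1..m}"
  shows "(\<integral>\<^sup>+x. ennreal ((L2_set (\<lambda>i. ms_estimator d n J x i - \<theta> 0 i) {..<d})\<^sup>2) \<partial>P)
    \<le> 4 * (\<integral>\<^sup>+x. ennreal ((L2_set (\<lambda>i. ms_candidate d n S x i - \<theta> 0 i) {..<d})\<^sup>2) \<partial>P)
      + 6 * ennreal (2 * K * real d / real (n 0))"
proof -
  let ?z = "\<lambda>x. L2_set (noise Half1 x) {..<d}"
  note sg = C\<tau> obs_size_pos[OF Half1_in] \<tau> sub_gaussian_noise[OF Half1_in]
  have [measurable]: "?z \<in> borel_measurable P" unfolding L2_set_def using Half1_in by measurable
  have "(\<integral>\<^sup>+x. ennreal ((?z x)\<^sup>2) \<partial>P) = (\<integral>\<^sup>+x. ennreal (\<Sum>i<d. (noise Half1 x i)\<^sup>2) \<partial>P)"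
    by (simp add: L2_set_def sum_nonneg)
  also have "\<dots> = ennreal (expectation (\<lambda>x. \<Sum>i<d. (noise Half1 x i)\<^sup>2))"
    by (rule nn_integral_eq_integral[OF sub_gaussian_norm(1)[OF sg]]) (simp add: sum_nonneg)
  also have "\<dots> \<le> ennreal (2 * K * real d / real (n 0))"
    using sub_gaussian_norm(2)[OF sg] by (intro ennreal_leI) (simp add: K_def field_simps)
  finally have z2: "(\<integral>\<^sup>+x. ennreal ((?z x)\<^sup>2) \<partial>P) \<le> ennreal (2 * K * real d / real (n 0))" .
  have "(\<Sum>i<d. v i * noise Half1 x i) \<le> ?z x * L2_set v {..<d}" for v x
  proof -
    have "(\<Sum>i<d. v i * noise Half1 x i) \<le> (\<Sum>i<d. \<bar>v i\<bar> * \<bar>noise Half1 x i\<bar>)"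
      by (intro sum_mono) (simp add: abs_mult[symmetric])
    also have "\<dots> \<le> L2_set v {..<d} * ?z x" by (rule L2_set_mult_ineq)
    finally show ?thesis by (simp add: mult.commute)
  qed
  then have "(\<integral>\<^sup>+x. ennreal ((L2_set (\<lambda>i. ms_estimator d n J x i - \<theta> 0 i) {..<d})\<^sup>2) \<partial>P)
    \<le> 4 * (\<integral>\<^sup>+x. ennreal ((L2_set (\<lambda>i. ms_candidate d n S x i - \<theta> 0 i) {..<d})\<^sup>2) \<partial>P)
      + 6 * (\<integral>\<^sup>+x. ennreal ((?z x)\<^sup>2) \<partial>P)"
    by (intro ms_risk S) auto
  also have "\<dots> \<le> 4 * (\<integral>\<^sup>+x. ennreal ((L2_set (\<lambda>i. ms_candidate d n S x i - \<theta> 0 i) {..<d})\<^sup>2) \<partial>P)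
      + 6 * ennreal (2 * K * real d / real (n 0))"
    by (intro add_left_mono mult_left_mono z2) simp
  finally show ?thesis .
qed

lemma indep_first_half:
  "indep_var (data_space (split_design m - {Half1}) d) (\<lambda>x. restrict x (split_design m - {Half1}))
     (data_space {Half1} d) (\<lambda>x. restrict x {Half1})"
  unfolding data_space_def
  by (rule indep_var_restrict[OF indep_obs, where A = "split_design m - {Half1}" and B = "{Half1}"])
     (use Half1_in in auto)

text \<open>
  The candidates are functions of the data other than the first half, hence each of the \<open>2\<^sup>m\<close>
  directions is independent of the noise of that half. A union bound over them costs a factor
  \<open>2\<^sup>m \<le> exp m\<close>, which is compensated by raising the level from \<open>u k\<close> to \<open>u (m + k)\<close>.
\<close>

lemma ms_risk_selection:
  assumes S: "S \<subseteq> {1..m}"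
  shows "(\<integral>\<^sup>+x. ennreal ((L2_set (\<lambda>i. ms_estimator d n J x i - \<theta> 0 i) {..<d})\<^sup>2) \<partial>P)
    \<le> 4 * (\<integral>\<^sup>+x. ennreal ((L2_set (\<lambda>i. ms_candidate d n S x i - \<theta> 0 i) {..<d})\<^sup>2) \<partial>P)
      + 6 * ennreal (4 * \<tau>\<^sup>2 / real (n 0) * (real m + 1 + C\<tau>))"
proof -
  define g where "g T x i = ms_candidate d n T x i - ms_candidate d n S x i" for T x i
  define ip where "ip T x = (\<Sum>i<d. g T x i * noise Half1 x i)" for T x
  define l where "l T x = L2_set (g T x) {..<d}" for T x
  define z where "z x = Max ((\<lambda>T. ip T x / l T x) ` Pow {1..m})" for x
  \<comment> \<open>chosen so that the tail bound at \<open>sqrt (u y)\<close> is \<open>C\<tau> * exp (- y)\<close>\<close>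
  define u where "u = 4 * \<tau>\<^sup>2 / real (n 0)"
  define E where "E k T = {x \<in> space P. ip T x > sqrt (u * (real m + real k)) * l T x}" for k T
  have n0: "real (n 0) > 0" using size_pos[of 0] by simp
  have u: "u > 0" using n0 \<tau> by (simp add: u_def)
  note H = Half1_in
  have ip_meas [measurable]: "ip T \<in> borel_measurable P" and l_meas [measurable]: "l T \<in> borel_measurable P"
    if "T \<subseteq> {1..m}" for T
    unfolding ip_def l_def g_def L2_set_def using that S H by measurable
  have z_meas: "z \<in> borel_measurable P"
    unfolding z_def by (intro borel_measurable_Max borel_measurable_divide ip_meas l_meas) auto
  have ge: "ip T x / l T x \<le> z x" if "T \<subseteq> {1..m}" for T x
    unfolding z_def using that by (intro Max_ge) auto
  \<comment> \<open>\<open>T = S\<close> contributes \<open>0 / 0 = 0\<close> to the maximum\<close>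
  have z_nonneg: "z x \<ge> 0" for x using ge[OF S, of x] by (simp add: ip_def g_def)
  have ip_le: "ip T x \<le> z x * l T x" if "T \<subseteq> {1..m}" for T x
  proof (cases "l T x = 0")
    case True
    then have "ip T x = 0" by (simp add: l_def ip_def L2_set_eq_0_iff)
    then show ?thesis using True by simp
  next
    case False
    then have "l T x > 0" using L2_set_nonneg[of "g T x" "{..<d}"] unfolding l_def by linarith
    then show ?thesis using ge[OF that, of x] by (simp add: pos_divide_le_eq)
  qed
  have E_events: "E k T \<in> events" if "T \<subseteq> {1..m}" for k T
    unfolding E_def using that by measurable
  have E_prob: "prob (E k T) \<le> C\<tau> * exp (- (real m + real k))" if T: "T \<subseteq> {1..m}" and k: "k \<ge> 1" for k T
  proof -
    let ?D = "split_design m - {Half1}"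
    have D: "Half2 \<in> ?D" "Source ` T \<subseteq> ?D" "Source ` S \<subseteq> ?D"
      using S T by (auto simp: split_design_def)
    have local: "ms_candidate d n V (restrict x ?D) = ms_candidate d n V x" if "Source ` V \<subseteq> ?D" for V x
    proof -
      have "restrict x ?D (Source k) = x (Source k)" if "k \<in> V" for k
        using that \<open>Source ` V \<subseteq> ?D\<close> by auto
      then show ?thesis using D(1) by (simp add: ms_candidate_def)
    qed
    have "prob {x \<in> space P. (\<Sum>i<d. g T (restrict x ?D) i * noise Half1 x i)
          > sqrt (u * (real m + real k)) * L2_set (g T (restrict x ?D)) {..<d}}
        \<le> C\<tau> * exp (- obs_size n Half1 * (sqrt (u * (real m + real k)))\<^sup>2 / (2 * \<tau>\<^sup>2))"
    proof (rule sub_gaussian_random_direction[OF C\<tau> obs_size_pos[OF H] \<tau> sub_gaussian_noise[OF H] _ indep_first_half,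
          where f = "\<lambda>i y. y Half1 i - \<theta> 0 i"])
      show "sqrt (u * (real m + real k)) > 0" using u k by simp
      show "(\<lambda>v. g T v i) \<in> borel_measurable (data_space ?D d)" if "i < d" for i
        unfolding g_def using that D by (intro borel_measurable_diff ms_candidate_measurable) auto
      show "noise Half1 x i = restrict x {Half1} Half1 i - \<theta> 0 i" for x i by (simp add: noise_def)
      show "(\<lambda>y. y Half1 i - \<theta> 0 i) \<in> borel_measurable (data_space {Half1} d)" if "i < d" for i
        using that by (intro borel_measurable_diff measurable_obs_coord) auto
    qed
    also have "{x \<in> space P. (\<Sum>i<d. g T (restrict x ?D) i * noise Half1 x i)
          > sqrt (u * (real m + real k)) * L2_set (g T (restrict x ?D)) {..<d}} = E k T"
      by (simp add: E_def ip_def l_def g_def[abs_def] local D)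
    also have "- obs_size n Half1 * (sqrt (u * (real m + real k)))\<^sup>2 / (2 * \<tau>\<^sup>2) = - (real m + real k)"
    proof -
      have "(sqrt (u * (real m + real k)))\<^sup>2 = u * (real m + real k)" using u by simp
      then show ?thesis using n0 \<tau> by (simp add: u_def field_simps)
    qed
    finally show ?thesis .
  qed
  have "(\<integral>\<^sup>+x. ennreal ((z x)\<^sup>2) \<partial>P) \<le> ennreal (u * (real m + 1 + C\<tau>))"
  proof (rule nn_integral_le_from_level_tails[where A = "\<lambda>k. \<Union>T\<in>Pow {1..m}. E k T"])
    show "(\<Union>T\<in>Pow {1..m}. E k T) \<in> events" for k using E_events by (intro sets.finite_UN) auto
  next
    fix x and k :: nat assume x: "x \<in> space P" and k: "k \<ge> 1" and big: "(z x)\<^sup>2 > u * (real m + real k)"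
    define t where "t = sqrt (u * (real m + real k))"
    have t: "t > 0" using u k by (simp add: t_def)
    have "t < z x" using real_sqrt_less_mono[OF big] z_nonneg[of x] by (simp add: t_def)
    moreover have "z x \<in> (\<lambda>T. ip T x / l T x) ` Pow {1..m}" unfolding z_def by (intro Max_in) auto
    then obtain T where T: "T \<subseteq> {1..m}" "z x = ip T x / l T x" by auto
    ultimately have tz: "t < ip T x / l T x" by simp
    then have "l T x \<noteq> 0" using t by auto
    then have "l T x > 0" using L2_set_nonneg[of "g T x" "{..<d}"] unfolding l_def by linarith
    then have "ip T x > t * l T x" using tz by (simp add: pos_less_divide_eq)
    then show "x \<in> (\<Union>T\<in>Pow {1..m}. E k T)" using T x by (auto simp: E_def t_def)
  next
    fix k :: nat assume k: "k \<ge> 1"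
    have "prob (\<Union>T\<in>Pow {1..m}. E k T) \<le> (\<Sum>T\<in>Pow {1..m}. prob (E k T))"
      using E_events by (intro finite_measure_subadditive_finite) auto
    also have "\<dots> \<le> (\<Sum>T\<in>Pow {1..m}. C\<tau> * exp (- (real m + real k)))"
      using E_prob k by (intro sum_mono) auto
    also have "\<dots> = (2 ^ m * exp (- real m)) * (C\<tau> * exp (- real k))"
      using exp_add[of "- real m" "- real k"] by (simp add: card_Pow)
    also have "\<dots> \<le> 1 * (C\<tau> * exp (- real k))"
    proof (rule mult_right_mono)
      have "(2::real) ^ m \<le> exp 1 ^ m" using exp_ge_add_one_self[of 1] by (intro power_mono) auto
      also have "\<dots> = exp (real m)" by (simp add: exp_of_nat_mult[symmetric])
      finally show "2 ^ m * exp (- real m) \<le> 1" by (simp add: exp_minus field_simps)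
    qed (use C\<tau> in auto)
    finally show "prob (\<Union>T\<in>Pow {1..m}. E k T) \<le> C\<tau> * exp (- real k)" by simp
  qed (use u C\<tau> in auto)
  then have z2: "(\<integral>\<^sup>+x. ennreal ((z x)\<^sup>2) \<partial>P) \<le> ennreal (4 * \<tau>\<^sup>2 / real (n 0) * (real m + 1 + C\<tau>))"
    by (simp add: u_def)
  have "(\<integral>\<^sup>+x. ennreal ((L2_set (\<lambda>i. ms_estimator d n J x i - \<theta> 0 i) {..<d})\<^sup>2) \<partial>P)
    \<le> 4 * (\<integral>\<^sup>+x. ennreal ((L2_set (\<lambda>i. ms_candidate d n S x i - \<theta> 0 i) {..<d})\<^sup>2) \<partial>P)
      + 6 * (\<integral>\<^sup>+x. ennreal ((z x)\<^sup>2) \<partial>P)"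
    using ip_le unfolding ip_def l_def g_def by (intro ms_risk S z_meas z_nonneg) auto
  also have "\<dots> \<le> 4 * (\<integral>\<^sup>+x. ennreal ((L2_set (\<lambda>i. ms_candidate d n S x i - \<theta> 0 i) {..<d})\<^sup>2) \<partial>P)
      + 6 * ennreal (4 * \<tau>\<^sup>2 / real (n 0) * (real m + 1 + C\<tau>))"
    by (intro add_left_mono mult_left_mono z2) simp
  finally show ?thesis .
qed

end

end

section \<open>Comparison with the oracle rate\<close>

lemma oracle_rate_attained:
  obtains S q where "S \<subseteq> {1..m}" "q \<ge> 0" "\<And>k. k \<in> S \<Longrightarrow> h k \<le> q"
    "oracle_rate d m n \<tau> h = real d * \<tau>\<^sup>2 / (real (n 0) + (\<Sum>k\<in>S. real (n k))) + q\<^sup>2"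
proof -
  let ?F = "\<lambda>S. real d * \<tau>\<^sup>2 / real (\<Sum>k\<in>S. n k) + Max ((\<lambda>k. ((h(0 := 0)) k)\<^sup>2) ` S)"
  have "oracle_rate d m n \<tau> h \<in> ?F ` {S. {0} \<subseteq> S \<and> S \<subseteq> {0..m}}"
    unfolding oracle_rate_def
  proof (rule Min_in)
    have "{S. {0} \<subseteq> S \<and> S \<subseteq> {0..m}} \<subseteq> Pow {0..m}" by auto
    then show "finite (?F ` {S. {0} \<subseteq> S \<and> S \<subseteq> {0..m}})" by (meson finite_Pow_iff finite_atLeastAtMost finite_imageI finite_subset)
    have "{0} \<in> {S. {0} \<subseteq> S \<and> S \<subseteq> {0..m}}" by auto
    then show "?F ` {S. {0} \<subseteq> S \<and> S \<subseteq> {0..m}} \<noteq> {}" by blast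
  qed
  then obtain T where T: "0 \<in> T" "T \<subseteq> {0..m}" "oracle_rate d m n \<tau> h = ?F T" by auto
  define S where "S = T - {0}"
  define M where "M = Max ((\<lambda>k. ((h(0 := 0)) k)\<^sup>2) ` T)"
  have fin: "finite T" using T(2) finite_subset by blast
  have le_M: "((h(0 := 0)) k)\<^sup>2 \<le> M" if "k \<in> T" for k
    unfolding M_def using fin that by (intro Max_ge) auto
  have M: "M \<ge> 0" using le_M[OF T(1)] by simp
  have "(\<Sum>k\<in>T. n k) = n 0 + (\<Sum>k\<in>S. n k)"
    unfolding S_def using fin T(1) by (rule sum.remove)
  then have sum: "real (\<Sum>k\<in>T. n k) = real (n 0) + (\<Sum>k\<in>S. real (n k))" by simp
  show ?thesis
  proof (rule that[of S "sqrt M"])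
    show "S \<subseteq> {1..m}" using T(2) by (auto simp: S_def)
    show "h k \<le> sqrt M" if "k \<in> S" for k
      using le_M[of k] that by (intro real_le_rsqrt) (auto simp: S_def)
    show "oracle_rate d m n \<tau> h = real d * \<tau>\<^sup>2 / (real (n 0) + (\<Sum>k\<in>S. real (n k))) + (sqrt M)\<^sup>2"
      using T(3) M unfolding sum M_def[symmetric] by simp
  qed (use M in simp)
qed

text \<open>
  If \<open>n 0 \<le> m * n1\<close>, every pooled sample has size at most \<open>2 * m * n1\<close>. Hence the oracle rate is not
  smaller than the target-only rate \<open>d * \<tau>\<^sup>2 / n 0\<close> divided by \<open>2 \<kappa>\<close>, with \<open>\<kappa> = m * n1 / n 0\<close>.
  The terms of the risk that carry the factor \<open>1 / n 0\<close> are compared with it this way.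
\<close>

lemma (in split_model) ms_risk_le_oracle_rate:
  assumes J: "ms_selector d m n (Pow {1..m}) J"
    and m: "m \<ge> 1" and equal: "\<And>k. k \<in> {1..m} \<Longrightarrow> n k = n1" and relevant: "n 0 \<le> m * n1"
  shows "(\<integral>\<^sup>+x. ennreal ((L2_set (\<lambda>i. ms_estimator d n J x i - \<theta> 0 i) {..<d})\<^sup>2) \<partial>P)
    \<le> ennreal (100 * (2 + 4 * C\<tau>)
        * max (min 1 (real m / real d) * (real m * real n1 / real (n 0))) 1 * oracle_rate d m n \<tau> h)"
    (is "?risk \<le> ennreal (100 * ?c * ?Q * ?R)")
proof -
  let ?cand = "\<lambda>S. \<integral>\<^sup>+x. ennreal ((L2_set (\<lambda>i. ms_candidate d n S x i - \<theta> 0 i) {..<d})\<^sup>2) \<partial>P"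
  define \<kappa> where "\<kappa> = real m * real n1 / real (n 0)"
  have combine: "?risk \<le> ennreal r"
    if "?risk \<le> 4 * ?cand S + 6 * ennreal b" "?cand S \<le> ennreal a" "a \<ge> 0" "b \<ge> 0" "4 * a + 6 * b \<le> r"
    for S a b r
  proof -
    have "4 * ?cand S + 6 * ennreal b \<le> ennreal 4 * ennreal a + ennreal 6 * ennreal b"
      using mult_left_mono[OF that(2), of 4] by (simp add: add_right_mono)
    also have "\<dots> = ennreal (4 * a + 6 * b)"
      using that(3,4) by (simp add: ennreal_mult[symmetric] ennreal_plus[symmetric]
        del: ennreal_plus ennreal_numeral)
    also have "\<dots> \<le> ennreal r" using that(5) by (rule ennreal_leI)
    finally show ?thesis using that(1) by (rule order_trans[rotated])
  qed
  have n0: "real (n 0) > 0" and d0: "real d > 0" and n1: "real n1 > 0"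
    using size_pos[of 0] size_pos[of 1] equal[of 1] m d by auto
  have c: "?c \<ge> 2" "?c \<ge> 2 + C\<tau>" using C\<tau> by auto
  have Q: "?Q \<ge> 1" by simp
  obtain S q where S: "S \<subseteq> {1..m}" and q: "q \<ge> 0" "\<And>k. k \<in> S \<Longrightarrow> h k \<le> q"
    and R: "?R = real d * \<tau>\<^sup>2 / (real (n 0) + (\<Sum>k\<in>S. real (n k))) + q\<^sup>2"
    using oracle_rate_attained[of m h d n \<tau>] by metis
  have cardS: "card S \<le> m" using card_mono[OF _ S] by simp
  have sumS: "(\<Sum>k\<in>S. real (n k)) = real (card S) * real n1"
    using equal S by (subst sum.cong[OF refl, of S _ "\<lambda>_. real n1"]) auto
  define N where "N = real (n 0) + (\<Sum>k\<in>S. real (n k))"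
  have N: "N > 0" using n0 by (simp add: N_def sum_nonneg add_pos_nonneg)
  have "real (n 0) \<le> real m * real n1" using relevant by (metis of_nat_le_iff of_nat_mult)
  moreover have "real (card S) * real n1 \<le> real m * real n1"
    using cardS n1 by (intro mult_right_mono) auto
  ultimately have N_le: "N \<le> 2 * (real m * real n1)" unfolding N_def sumS by linarith
  have V: "real d * \<tau>\<^sup>2 / N \<le> ?R" using R by (simp add: N_def)
  then have R0: "?R \<ge> 0" using N by (meson divide_nonneg_pos mult_nonneg_nonneg of_nat_0_le_iff order_trans zero_le_power2)
  have "real d * \<tau>\<^sup>2 \<le> ?R * N" using V N by (simp add: pos_divide_le_eq)
  also have "\<dots> \<le> ?R * (2 * (real m * real n1))" using N_le R0 by (rule mult_left_mono)
  finally have "real d * \<tau>\<^sup>2 / real (n 0) \<le> ?R * (2 * (real m * real n1)) / real (n 0)"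
    using n0 by (intro divide_right_mono) auto
  then have target: "real d * \<tau>\<^sup>2 / real (n 0) \<le> 2 * \<kappa> * ?R" by (simp add: \<kappa>_def mult_ac)
  show ?thesis
  proof (cases "d < m")
    case True
    have Q_ge: "\<kappa> \<le> ?Q" using True d0 by (simp add: \<kappa>_def)
    have cand: "?cand {} \<le> ennreal (4 * K * (real d + 1) / real (n 0))"
      using candidate_risk[of "{}" 0] by (simp add: mult_ac)
    show ?thesis
    proof (rule combine[OF ms_risk_dimension[OF J] cand])
      have "4 * (4 * K * (real d + 1) / real (n 0)) + 6 * (2 * K * real d / real (n 0))
          = K * (28 * real d + 16) / real (n 0)" by (simp add: add_divide_distrib[symmetric] algebra_simps)
      also have "\<dots> \<le> K * (44 * real d) / real (n 0)"
        using d n0 C\<tau> by (intro divide_right_mono mult_left_mono) (auto simp: K_def)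
      also have "\<dots> = 44 * ?c * (real d * \<tau>\<^sup>2 / real (n 0))" by (simp add: K_def)
      also have "\<dots> \<le> 44 * ?c * (2 * \<kappa> * ?R)" using target c by (intro mult_left_mono) auto
      also have "\<dots> = 88 * ?c * \<kappa> * ?R" by simp
      also have "\<dots> \<le> 100 * ?c * ?Q * ?R"
        using Q_ge c R0 n0 by (intro mult_right_mono mult_mono) (auto simp: \<kappa>_def)
      finally show "4 * (4 * K * (real d + 1) / real (n 0)) + 6 * (2 * K * real d / real (n 0))
          \<le> 100 * ?c * ?Q * ?R" .
    qed (use C\<tau> in \<open>auto simp: K_def\<close>)
  next
    case False
    have Q_ge: "real m / real d * \<kappa> \<le> ?Q" using False d0 by (simp add: \<kappa>_def)
    \<comment> \<open>the candidate uses half of the target sample, so it pools at least half of \<open>N\<close>\<close>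
    let ?H = "(\<Sum>k\<in>S. real (n k)) + real (n 0) / 2"
    have H: "?H \<ge> N / 2" by (simp add: N_def sum_nonneg)
    let ?a = "2 * (K * (real d + real (card S) + 1) / ?H) + 2 * q\<^sup>2"
    let ?b = "4 * \<tau>\<^sup>2 / real (n 0) * (real m + 1 + C\<tau>)"
    have K0: "K \<ge> 0" using C\<tau> by (simp add: K_def)
    have "K * (real d + real (card S) + 1) / ?H \<le> K * (3 * real d) / (N / 2)"
      using H N K0 cardS False d by (intro frac_le mult_left_mono) auto
    also have "\<dots> = 6 * ?c * (real d * \<tau>\<^sup>2 / N)" by (simp add: K_def)
    finally have "?a \<le> 2 * (6 * ?c * (real d * \<tau>\<^sup>2 / N)) + 2 * q\<^sup>2"
      by (intro add_right_mono mult_left_mono) auto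
    also have "\<dots> = 12 * ?c * (real d * \<tau>\<^sup>2 / N) + 2 * q\<^sup>2" by simp
    also have "\<dots> \<le> 12 * ?c * (real d * \<tau>\<^sup>2 / N) + 12 * ?c * q\<^sup>2"
      using c by (intro add_left_mono mult_right_mono) auto
    also have "\<dots> = 12 * ?c * ?R" by (simp add: R N_def distrib_left)
    finally have a: "?a \<le> 12 * ?c * ?R" .
    have "?b \<le> 4 * \<tau>\<^sup>2 / real (n 0) * (?c * real m)"
    proof (rule mult_left_mono)
      have "real m + 1 + C\<tau> \<le> (2 + C\<tau>) * real m"
      proof -
        have "real m \<ge> 1" using m by simp
        moreover have "C\<tau> * 1 \<le> C\<tau> * real m" using \<open>real m \<ge> 1\<close> C\<tau> by (intro mult_left_mono) auto
        ultimately show ?thesis by (simp add: distrib_right)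
      qed
      also have "\<dots> \<le> ?c * real m" using c by (intro mult_right_mono) auto
      finally show "real m + 1 + C\<tau> \<le> ?c * real m" .
    qed (use n0 in auto)
    also have "\<dots> = 4 * ?c * (real m / real d) * (real d * \<tau>\<^sup>2 / real (n 0))" using d0 by simp
    also have "\<dots> \<le> 4 * ?c * (real m / real d) * (2 * \<kappa> * ?R)" using target c by (intro mult_left_mono) auto
    also have "\<dots> = 8 * ?c * (real m / real d * \<kappa>) * ?R" by simp
    also have "\<dots> \<le> 8 * ?c * ?Q * ?R" using Q_ge R0 c by (intro mult_right_mono mult_left_mono) auto
    finally have b: "?b \<le> 8 * ?c * ?Q * ?R" .
    have "?c * ?R * 1 \<le> ?c * ?R * ?Q" using Q R0 c by (intro mult_left_mono) auto
    then have a': "?a \<le> 12 * (?c * ?Q * ?R)" using a by (simp only: mult_ac mult_1_left mult_1_right)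
    show ?thesis
    proof (rule combine[OF ms_risk_selection[OF J S] candidate_risk[OF S q]])
      have "?c * ?Q * ?R \<ge> 0" using c Q R0 by (intro mult_nonneg_nonneg) auto
      moreover have "?b \<le> 8 * (?c * ?Q * ?R)" using b by (simp only: mult.assoc)
      moreover have "4 * x + 6 * y \<le> 100 * w" if "w \<ge> 0" "x \<le> 12 * w" "y \<le> 8 * w" for x y w :: real
        using that by linarith
      ultimately have "4 * ?a + 6 * ?b \<le> 100 * (?c * ?Q * ?R)" using a' by blast
      then show "4 * ?a + 6 * ?b \<le> 100 * ?c * ?Q * ?R" by (simp only: mult.assoc)
      show "?a \<ge> 0" using K0 H N by (intro add_nonneg_nonneg mult_nonneg_nonneg divide_nonneg_nonneg)
        (auto simp: sum_nonneg)
      show "?b \<ge> 0" using C\<tau> n0 by (intro mult_nonneg_nonneg) auto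
    qed
  qed
qed

lemma ms_adaptation_cost_le:
  assumes C\<tau>: "C\<tau> > 0" and \<tau>: "\<tau> > 0" and d: "d \<ge> 1" and m: "m \<ge> 1"
    and n: "n 0 \<ge> 1" "n1 \<ge> 1" "\<And>k. k \<in> {1..m} \<Longrightarrow> n k = n1" "n 0 \<le> m * n1"
    and J: "ms_selector d m n (Pow {1..m}) J"
  shows "adaptation_cost C\<tau> d m n \<tau> (split_design m) (ms_estimator d n J) H
    \<le> ennreal (100 * (2 + 4 * C\<tau>) * max (min 1 (real m / real d) * (real m * real n1 / real (n 0))) 1)"
    (is "_ \<le> ennreal ?B")
  unfolding adaptation_cost_def
proof (rule SUP_least)
  fix h
  let ?R = "oracle_rate d m n \<tau> h"
  have R: "?R > 0"
  proof -
    obtain S q where "?R = real d * \<tau>\<^sup>2 / (real (n 0) + (\<Sum>k\<in>S. real (n k))) + q\<^sup>2"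
      using oracle_rate_attained[of m h d n \<tau>] by metis
    moreover have "real d * \<tau>\<^sup>2 / (real (n 0) + (\<Sum>k\<in>S. real (n k))) > 0"
      using d \<tau> n(1) by (intro divide_pos_pos mult_pos_pos add_pos_nonneg sum_nonneg) auto
    ultimately show ?thesis by (simp add: add_pos_nonneg)
  qed
  have B: "?B \<ge> 0" using C\<tau> by simp
  have "worst_risk C\<tau> d m n \<tau> (split_design m) (ms_estimator d n J) h \<le> ennreal (?B * ?R)"
    unfolding worst_risk_def
  proof (rule SUP_least, clarify)
    fix \<theta> P assume adm: "admissible C\<tau> d m n \<tau> (split_design m) h \<theta> P"
    interpret prob_space P using adm by (simp add: admissible_def)
    have size: "n k \<ge> 1" if "k \<le> m" for k using n that by (cases "k = 0") auto
    interpret split_model P C\<tau> \<tau> d m n h \<theta>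
      by unfold_locales (use C\<tau> \<tau> d size adm in auto)
    show "(\<integral>\<^sup>+x. ennreal ((L2_set (\<lambda>i. ms_estimator d n J x i - \<theta> 0 i) {..<d})\<^sup>2) \<partial>P) \<le> ennreal (?B * ?R)"
      by (rule ms_risk_le_oracle_rate[OF J m n(3,4)])
  qed
  then have "worst_risk C\<tau> d m n \<tau> (split_design m) (ms_estimator d n J) h / ennreal ?R
      \<le> ennreal (?B * ?R) / ennreal ?R"
    by (rule divide_right_mono_ennreal)
  also have "\<dots> = ennreal ?B" using R B by (subst divide_ennreal) auto
  finally show "worst_risk C\<tau> d m n \<tau> (split_design m) (ms_estimator d n J) h / ennreal ?R \<le> ennreal ?B" .
qed

lemma intrinsic_cost_le_ms:
  assumes "ms_selector d m n (Pow {1..m}) J"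
  shows "intrinsic_cost C\<tau> d m n \<tau> H
    \<le> adaptation_cost C\<tau> d m n \<tau> (split_design m) (ms_estimator d n J) H"
  unfolding intrinsic_cost_def
  using ms_estimator_measurable[OF assms]
  by (intro INF_lower2[where i = "(split_design m, ms_estimator d n J)"]) auto

theorem corollary12:
  fixes C\<tau> :: real
  assumes "C\<tau> > 0"
  shows "\<exists>C>0. \<forall>(m :: nat \<Rightarrow> nat) (ns :: nat \<Rightarrow> nat \<Rightarrow> nat) (n :: nat \<Rightarrow> nat)
           (d :: nat \<Rightarrow> nat) (\<tau> :: nat \<Rightarrow> real).
     (\<forall>i. m i \<ge> 1 \<and> n i \<ge> 1 \<and> ns i 0 \<ge> 1 \<and> d i \<ge> 1 \<and> \<tau> i > 0 \<and>
          (\<forall>k\<in>{1..m i}. ns i k = n i) \<and>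
          real (d i) * (\<tau> i)\<^sup>2 / real (ns i 0) \<le> 1) \<longrightarrow>
     (\<lambda>i. real (ns i 0) / (real (m i) * real (n i))) \<longlonglongrightarrow> 0 \<longrightarrow>
     (\<forall>\<^sub>F i in sequentially. \<forall>J. ms_selector (d i) (m i) (ns i) (Pow {1..m i}) J \<longrightarrow>
        intrinsic_cost C\<tau> (d i) (m i) (ns i) (\<tau> i) (unit_cube (m i))
          \<le> adaptation_cost C\<tau> (d i) (m i) (ns i) (\<tau> i) (split_design (m i))
              (ms_estimator (d i) (ns i) J) (unit_cube (m i)) \<and>
        adaptation_cost C\<tau> (d i) (m i) (ns i) (\<tau> i) (split_design (m i))
            (ms_estimator (d i) (ns i) J) (unit_cube (m i))
          \<le> ennreal (C * max (min 1 (real (m i) / real (d i)) * (real (m i) * real (n i) / real (ns i 0))) 1))"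
proof -
  let ?C = "100 * (2 + 4 * C\<tau>)"
  show ?thesis
  proof (intro exI[of _ ?C] conjI allI impI)
    show "?C > 0" using assms by simp
  next
    fix m :: "nat \<Rightarrow> nat" and ns :: "nat \<Rightarrow> nat \<Rightarrow> nat" and n d :: "nat \<Rightarrow> nat" and \<tau> :: "nat \<Rightarrow> real"
    assume par: "\<forall>i. m i \<ge> 1 \<and> n i \<ge> 1 \<and> ns i 0 \<ge> 1 \<and> d i \<ge> 1 \<and> \<tau> i > 0 \<and>
          (\<forall>k\<in>{1..m i}. ns i k = n i) \<and> real (d i) * (\<tau> i)\<^sup>2 / real (ns i 0) \<le> 1"
      and lim: "(\<lambda>i. real (ns i 0) / (real (m i) * real (n i))) \<longlonglongrightarrow> 0"
    have "\<forall>\<^sub>F i in sequentially. real (ns i 0) / (real (m i) * real (n i)) < 1"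
      using order_tendstoD(2)[OF lim, of 1] by simp
    then show "\<forall>\<^sub>F i in sequentially. \<forall>J. ms_selector (d i) (m i) (ns i) (Pow {1..m i}) J \<longrightarrow>
        intrinsic_cost C\<tau> (d i) (m i) (ns i) (\<tau> i) (unit_cube (m i))
          \<le> adaptation_cost C\<tau> (d i) (m i) (ns i) (\<tau> i) (split_design (m i))
              (ms_estimator (d i) (ns i) J) (unit_cube (m i)) \<and>
        adaptation_cost C\<tau> (d i) (m i) (ns i) (\<tau> i) (split_design (m i))
            (ms_estimator (d i) (ns i) J) (unit_cube (m i))
          \<le> ennreal (?C * max (min 1 (real (m i) / real (d i)) * (real (m i) * real (n i) / real (ns i 0))) 1)"
    proof (rule eventually_mono, intro allI impI conjI)
      fix i J
      assume small: "real (ns i 0) / (real (m i) * real (n i)) < 1"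
        and J: "ms_selector (d i) (m i) (ns i) (Pow {1..m i}) J"
      show "intrinsic_cost C\<tau> (d i) (m i) (ns i) (\<tau> i) (unit_cube (m i))
          \<le> adaptation_cost C\<tau> (d i) (m i) (ns i) (\<tau> i) (split_design (m i))
              (ms_estimator (d i) (ns i) J) (unit_cube (m i))"
        by (rule intrinsic_cost_le_ms[OF J])
      have "real (m i) * real (n i) > 0" using par[rule_format, of i] by simp
      then have "real (ns i 0) < real (m i * n i)" using small by (simp add: pos_divide_less_eq)
      then have "ns i 0 \<le> m i * n i" by (simp only: of_nat_less_iff less_imp_le)
      then show "adaptation_cost C\<tau> (d i) (m i) (ns i) (\<tau> i) (split_design (m i))
            (ms_estimator (d i) (ns i) J) (unit_cube (m i))
          \<le> ennreal (?C * max (min 1 (real (m i) / real (d i)) * (real (m i) * real (n i) / real (ns i 0))) 1)"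
        using par[rule_format, of i] assms J by (intro ms_adaptation_cost_le) auto
    qed
  qed
qed

end
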